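(* Let $f:\mathbb{R}^n\to\mathbb{R}$ be continuously differentiable, with global minimum value $f_{\mathrm{low}}:=\min_{x\in\mathbb{R}^n}f(x)$, and assume there exists $\mu_c>0$ such that $f(y)\ge f(x)+\nabla f(x)^T(y-x)+\frac{\mu_c}{2}\|y-x\|^2$ for all $x,y\in\mathbb{R}^n$. Consider a run of the trust-region algorithm described in the context. Assume there is $L\ge 1$ with $|f(x_k+s_k)-m_k(s_k)|\le \tfrac12(L+\|B_k\|)\|s_k\|^2$ for all $k\in\mathbb{N}$, and that there exist $\mu>0$ and $0<p\le 1$ such that $\max_{j=0,\ldots,k}\|B_j\|\le \mu(1+k^p)$ for all $k\in\mathbb{N}$. Assume that the algorithm generates infinitely many successful iterations. Let $\tau$ be a positive integer such that $\gamma_4\gamma_2^{\tau-1}<1$, let $\xi:=\sum_{k\in\mathbb{N}}(\gamma_4\gamma_2^{\tau-1})^{k/\tau}$, and let $$\kappa_0:=\frac{\psi_\beta(2\mu)}{\eta_1\kappa_{\mathrm{mdc}}a_{\min}},\qquad \kappa_3:=\psi_\beta(2\mu)\,\xi,\qquad \kappa_4:=\log_{\gamma_2}\left(\frac{a_{\min}}{\Delta_0}\right)+1.$$ Let $\delta_k:=f(x_k)-f_{\mathrm{low}}$, let $\epsilon>0$, and let $\widehat{k}_\epsilon$ be the first iteration such that $\delta_{\widehat{k}_\epsilon}>\epsilon$ and $\delta_{\widehat{k}_\epsilon+1}\le\epsilon$. If $0<p<1$, then $$\widehat{k}_\epsilon\le\left[(1-p)\left(\frac{\tau\kappa_0}{2\mu_c}\log\left(\frac{\delta_0}{\epsilon}\right)+\kappa_3\right)+\left((1-\alpha)\log_{\gamma_2}(\epsilon)+\kappa_4\right)^{1-p}\right]^{1/(1-p)}=O\left(\left[(1-p)\log(\epsilon^{-1})\right]^{1/(1-p)}\right).$$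 If $p=1$, then $$\widehat{k}_\epsilon\le\left((1-\alpha)\log_{\gamma_2}(\epsilon)+\kappa_4\right)\exp\left(\frac{\tau\kappa_0}{2\mu_c}\log\left(\frac{\delta_0}{\epsilon}\right)+\kappa_3\right)=O\left(\left((1-\alpha)\log_{\gamma_2}(\epsilon)+\kappa_4\right)\epsilon^{-\frac{\tau\kappa_0}{2\mu_c}}\right).$$
   Context: $\|\cdot\|$ is the Euclidean norm for vectors and the induced norm for matrices; $\mathbb{N}=\{0,1,2,\ldots\}$; by convention $0^0=1$. Trust-region algorithm. Fix constants $0<\eta_1\le\eta_2<1$, $0<\gamma_1\le\gamma_2<1\le\gamma_3\le\gamma_4$, $0<\kappa_{\mathrm{mdc}}\le\frac12$, $-1\le\alpha\le1$, $0\le\beta\le1$, $x_0\in\mathbb{R}^n$, $\Delta_0>0$. For $k=0,1,\ldots$: choose a symmetric $B_k\in\mathbb{R}^{n\times n}$ and set $m_k(s):=f(x_k)+\nabla f(x_k)^Ts+\frac12 s^TB_ks$ and $r_k:=\frac{\|\nabla f(x_k)\|^\alpha}{(1+\|B_k\|)^\beta}\Delta_k$. Let $s_{k,\mathrm{cp}}:=-t_k\nabla f(x_k)$, where $t_k$ minimizes $m_k(-t\nabla f(x_k))$ over $t\ge0$ with $\|t\nabla f(x_k)\|\le r_k$. Compute any $s_k$ with $\|s_k\|\le r_k$ and $m_k(0)-m_k(s_k)\ge2\kappa_{\mathrm{mdc}}(m_k(0)-m_k(s_{k,\mathrm{cp}}))$. Let $\rho_k:=\frac{f(x_k)-f(x_k+s_k)}{m_k(0)-m_k(s_k)}$.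 If $\rho_k\ge\eta_1$, set $x_{k+1}:=x_k+s_k$; otherwise $x_{k+1}:=x_k$. Choose $\Delta_{k+1}\in[\gamma_3\Delta_k,\gamma_4\Delta_k]$ if $\rho_k\ge\eta_2$; $\Delta_{k+1}\in[\gamma_2\Delta_k,\Delta_k]$ if $\eta_1\le\rho_k<\eta_2$; $\Delta_{k+1}\in[\gamma_1\Delta_k,\gamma_2\Delta_k]$ if $\rho_k<\eta_1$. Iteration $k$ is successful if $\rho_k\ge\eta_1$. $a_{\min}:=2\gamma_1\kappa_{\mathrm{mdc}}(1-\eta_2)\min\left\{1,\frac{\Delta_0}{\|\nabla f(x_0)\|^{1-\alpha}}\right\}$. For $x\ge0$, $\psi_\beta(x):=L+x$ if $\beta\in[0,1/L]$ and $\psi_\beta(x):=L(1+x)$ if $\beta\in(1/L,1]$. $\log$ is the natural logarithm and $\log_{\gamma_2}$ is the logarithm in base $\gamma_2$. The $O(\cdot)$ notation refers to $\epsilon\to0$.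
   Formalization: The two explicit bounds on the first crossing iteration are stated only for α = 1 or ε ≤ 2μ_c, since for α < 1 and larger ε they can fail (e.g. a flat quadratic with huge Δ_0) or be undefined; the O(·) claims as ε→0 are unrestricted. *)

theory Defs
  imports "HOL-Analysis.Analysis" "HOL-Library.Landau_Symbols"
begin

(* powr with the convention 0^0 = 1; powr itself has 0 powr 0 = 0. *)
definition rpow :: "real \<Rightarrow> real \<Rightarrow> real" where
  "rpow x a = (if x = 0 \<and> a = 0 then 1 else x powr a)"

(* The Euclidean-induced norm; the norm of the type real^'n^'n is the Frobenius norm. *)
definition opnorm :: "real^'n^'n \<Rightarrow> real" where
  "opnorm A = onorm (\<lambda>v. A *v v)"

(* In the following, g is the gradient of f. *)

definition tr_model ::
  "(real^'n \<Rightarrow> real) \<Rightarrow> (real^'n \<Rightarrow> real^'n) \<Rightarrow> real^'n \<Rightarrow> real^'n^'n \<Rightarrow> real^'n \<Rightarrow> real" where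
  "tr_model f g x B s = f x + g x \<bullet> s + 1/2 * (s \<bullet> (B *v s))"

definition tr_radius ::
  "real \<Rightarrow> real \<Rightarrow> (real^'n \<Rightarrow> real^'n) \<Rightarrow> real^'n \<Rightarrow> real^'n^'n \<Rightarrow> real \<Rightarrow> real" where
  "tr_radius \<alpha> \<beta> g x B \<Delta> = rpow (norm (g x)) \<alpha> / rpow (1 + opnorm B) \<beta> * \<Delta>"

definition tr_ratio ::
  "(real^'n \<Rightarrow> real) \<Rightarrow> (real^'n \<Rightarrow> real^'n) \<Rightarrow> real^'n \<Rightarrow> real^'n^'n \<Rightarrow> real^'n \<Rightarrow> real" where
  "tr_ratio f g x B s = (f x - f (x + s)) / (tr_model f g x B 0 - tr_model f g x B s)"

definition cauchy_stepsize ::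
  "(real^'n \<Rightarrow> real) \<Rightarrow> (real^'n \<Rightarrow> real^'n) \<Rightarrow> real^'n \<Rightarrow> real^'n^'n \<Rightarrow> real \<Rightarrow> real \<Rightarrow> bool" where
  "cauchy_stepsize f g x B r t \<longleftrightarrow>
     is_arg_min (\<lambda>t. tr_model f g x B (- (t *\<^sub>R g x))) (\<lambda>t. 0 \<le> t \<and> norm (t *\<^sub>R g x) \<le> r) t"

(* The sequences x, B, t, s, \<Delta> record the iterates, model Hessians, Cauchy step lengths,
   steps and radius parameters of a run; the freedom in choosing B, t, s and \<Delta> is
   expressed by constraints only. *)
definition trust_region_run ::
  "real \<Rightarrow> real \<Rightarrow> real \<Rightarrow> real \<Rightarrow> real \<Rightarrow> real \<Rightarrow> real \<Rightarrow> real \<Rightarrow> real \<Rightarrow>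
   (real^'n \<Rightarrow> real) \<Rightarrow> (real^'n \<Rightarrow> real^'n) \<Rightarrow> real^'n \<Rightarrow> real \<Rightarrow>
   (nat \<Rightarrow> real^'n) \<Rightarrow> (nat \<Rightarrow> real^'n^'n) \<Rightarrow> (nat \<Rightarrow> real) \<Rightarrow> (nat \<Rightarrow> real^'n) \<Rightarrow> (nat \<Rightarrow> real) \<Rightarrow> bool"
where
  "trust_region_run \<eta>\<^sub>1 \<eta>\<^sub>2 \<gamma>\<^sub>1 \<gamma>\<^sub>2 \<gamma>\<^sub>3 \<gamma>\<^sub>4 \<kappa>mdc \<alpha> \<beta> f g x\<^sub>0 \<Delta>\<^sub>0 x B t s \<Delta> \<longleftrightarrow>
     x 0 = x\<^sub>0 \<and> \<Delta> 0 = \<Delta>\<^sub>0 \<and>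
     (\<forall>k.
       let m = tr_model f g (x k) (B k);
           r = tr_radius \<alpha> \<beta> g (x k) (B k) (\<Delta> k);
           scp = - (t k *\<^sub>R g (x k));
           \<rho> = tr_ratio f g (x k) (B k) (s k)
       in transpose (B k) = B k \<and>
          cauchy_stepsize f g (x k) (B k) r (t k) \<and>
          norm (s k) \<le> r \<and>
          m 0 - m (s k) \<ge> 2 * \<kappa>mdc * (m 0 - m scp) \<and>
          x (Suc k) = (if \<rho> \<ge> \<eta>\<^sub>1 then x k + s k else x k) \<and>
          (\<rho> \<ge> \<eta>\<^sub>2 \<longrightarrow> \<Delta> (Suc k) \<in> {\<gamma>\<^sub>3 * \<Delta> k .. \<gamma>\<^sub>4 * \<Delta> k}) \<and>
          (\<eta>\<^sub>1 \<le> \<rho> \<and> \<rho> < \<eta>\<^sub>2 \<longrightarrow> \<Delta> (Suc k) \<in> {\<gamma>\<^sub>2 * \<Delta> k .. \<Delta> k}) \<and>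
          (\<rho> < \<eta>\<^sub>1 \<longrightarrow> \<Delta> (Suc k) \<in> {\<gamma>\<^sub>1 * \<Delta> k .. \<gamma>\<^sub>2 * \<Delta> k}))"

definition psi :: "real \<Rightarrow> real \<Rightarrow> real \<Rightarrow> real" where
  "psi \<beta> L x = (if \<beta> \<le> 1 / L then L + x else L * (1 + x))"

definition first_crossing :: "(nat \<Rightarrow> real) \<Rightarrow> real \<Rightarrow> nat \<Rightarrow> bool" where
  "first_crossing \<delta> \<epsilon> k \<longleftrightarrow>
     (\<delta> k > \<epsilon> \<and> \<delta> (Suc k) \<le> \<epsilon>) \<and> (\<forall>j<k. \<not> (\<delta> j > \<epsilon> \<and> \<delta> (Suc j) \<le> \<epsilon>))"

end

theory Submission
  imports Defs
begin


text \<open>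
  The gap \<open>\<delta>\<close> to the minimum value contracts at every successful iteration, and the contraction
  factor can be tracked through the size of the model Hessians.  Three facts combine.

  The first is a lower bound for the radius parameter.  Let \<open>M\<close> bound the Hessian norms up to
  iteration \<open>k\<close>.  If the radius parameter is below a constant times
  \<open>norm (g (x k)) powr (1 - \<alpha>) * (1 + M) powr \<beta> / psi \<beta> L M\<close>, the iteration is very successful and
  does not shrink it, so the parameter can never fall far below such a threshold
  (\<open>\<Delta>_lower_bound\<close>).  The power of \<open>1 + M\<close> outweighs the denominator in the radius, and the Cauchy
  point decreases the model by at least a multiple of \<open>G\<^sup>2 / psi \<beta> L M\<close>, where \<open>G\<close> bounds the
  norms of the gradients seen so far from below.  Strong
  convexity gives \<open>2 * \<mu>c * \<delta> k \<le> (norm (g (x k)))\<^sup>2\<close>, and \<open>\<delta>\<close> never increases, so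
  \<open>G = sqrt (2 * \<mu>c * \<delta> k)\<close> is admissible.  A success at iteration \<open>k\<close> therefore multiplies the
  gap by at most \<open>1 - const * weight k\<close>, where \<open>weight k\<close> is \<open>k powr (- p)\<close>, the inverse of the
  order of growth of the Hessians.  Taking logarithms bounds the sum of the weights of the
  successful iterations by \<open>\<kappa>\<^sub>0 / (2 * \<mu>c) * ln (\<delta> 0 / \<epsilon>)\<close> (\<open>sum_success_weights_le\<close>).

  The second passes from successful iterations to all iterations, by Powell's argument.  Fix an
  offset \<open>a \<le> k\<close>.  If the successes before \<open>k\<close> number more than \<open>(k - a) / \<tau>\<close>, the weight of \<open>k\<close> is
  charged to an earlier success, and each success is charged at most \<open>\<tau>\<close> times
  (\<open>sum_dominated_indices_le\<close>).  Otherwise the shrinking steps dominate and the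
  radius parameter is at most
  \<open>\<Delta>\<^sub>0 * \<gamma>\<^sub>2 ^ a * (\<gamma>\<^sub>4 * \<gamma>\<^sub>2 ^ (\<tau> - 1)) powr ((k - a) / \<tau>)\<close>; compared with the lower bound, this
  forces the weight of \<open>k\<close> to be geometrically small, and all such weights together contribute at
  most \<open>\<kappa>\<^sub>3\<close>.  The offset serves to make \<open>\<Delta>\<^sub>0 * \<gamma>\<^sub>2 ^ a\<close> absorb the factor
  \<open>amin * \<epsilon> powr (1 - \<alpha>)\<close> of the lower bound; this is the source of the logarithm of \<open>\<epsilon>\<close> in base
  \<open>\<gamma>\<^sub>2\<close>.

  The third is calculus: the sum of \<open>k powr (- p)\<close> over \<open>k\<close> from \<open>a\<close> to below the crossing iteration
  dominates the integral of that power over the same range, which is a difference of powers with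
  exponent \<open>1 - p\<close>, or of logarithms when \<open>p = 1\<close>.  Solving for the crossing iteration gives the two
  bounds.
\<close>

section \<open>Powers, sums and integrals\<close>

lemma powr_Bernoulli:
  fixes u r :: real
  assumes "0 \<le> u" "0 \<le> r" "r \<le> 1"
  shows "(1 + u) powr r \<le> 1 + r * u"
  using Youngs_inequality_0[of r "1 - r" "1 + u" 1] assms by (simp add: algebra_simps)

text \<open>
  The left-hand side is \<open>1 - p\<close> times the integral of the decreasing function \<open>u powr (- p)\<close> from
  \<open>a\<close> to \<open>n\<close>.  Bernoulli's inequality for \<open>1 + 1 / k\<close> is the comparison on a single unit interval.
\<close>
lemma integral_le_sum_powr:
  fixes p :: real and a n :: nat
  assumes p: "0 \<le> p" "p < 1" and a: "1 \<le> a" and n: "a \<le> n"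
  shows "real n powr (1 - p) - real a powr (1 - p)
           \<le> (1 - p) * (\<Sum>k = a..<n. real k powr (- p))"
  using n
proof (induction n rule: dec_induct)
  case base
  then show ?case by simp
next
  case (step k)
  have k: "0 < real k" using step a by simp
  have "real (Suc k) powr (1 - p) = (real k * (1 + 1 / real k)) powr (1 - p)"
    using k by (simp add: distrib_left add.commute)
  also have "\<dots> = real k powr (1 - p) * (1 + 1 / real k) powr (1 - p)"
    using k by (simp add: powr_mult)
  also have "\<dots> \<le> real k powr (1 - p) * (1 + (1 - p) * (1 / real k))"
    using k p by (intro mult_left_mono powr_Bernoulli) auto
  also have "\<dots> = real k powr (1 - p) + (1 - p) * real k powr (- p)"
  proof -
    have "real k powr (1 - p) / real k = real k powr (- p)"
      using k powr_diff[of "real k" "1 - p" 1] by simp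
    moreover have "real k powr (1 - p) * (1 + (1 - p) * (1 / real k))
        = real k powr (1 - p) + (1 - p) * (real k powr (1 - p) / real k)"
      by (simp add: distrib_left)
    ultimately show ?thesis by simp
  qed
  finally show ?case using step by (simp add: algebra_simps)
qed

lemma ln_le_sum_inverse:
  fixes a n :: nat
  assumes a: "1 \<le> a" and n: "a \<le> n"
  shows "ln (real n) - ln (real a) \<le> (\<Sum>k = a..<n. real k powr (- 1))"
  using n
proof (induction n rule: dec_induct)
  case base
  then show ?case by simp
next
  case (step k)
  have k: "0 < real k" using step a by simp
  have "ln (real (Suc k)) = ln (real k * (1 + 1 / real k))"
    using k by (simp add: distrib_left add.commute)
  also have "\<dots> = ln (real k) + ln (1 + 1 / real k)"
    using k by (intro ln_mult_pos) (auto intro: add_pos_pos)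
  also have "\<dots> \<le> ln (real k) + real k powr (- 1)"
    using k ln_add_one_self_le_self[of "1 / real k"] by (simp add: powr_minus_divide)
  finally show ?case using step by simp
qed

section \<open>Charging iterations to successes\<close>

text \<open>
  The \<open>i\<close>-th element of \<open>G\<close> (counted from \<open>0\<close>) is at least \<open>a + i\<close>, hence preceded by more than
  \<open>i / \<tau>\<close> elements of \<open>S\<close>.  Charging it to the element of \<open>S\<close> with index \<open>i div \<tau>\<close> uses each
  element of \<open>S\<close> at most \<open>\<tau>\<close> times, and \<open>w\<close> is no smaller there.  The proof replaces this matching
  by summation by parts: the surplus \<open>?c\<close> of charges that are still available is nonnegative, and its
  value in units of the current weight stays below the difference of the two sums.
\<close>
lemma sum_dominated_indices_le:
  fixes w :: "nat \<Rightarrow> real" and S :: "nat set" and a \<tau> n :: nat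
  assumes w: "antimono w" "\<And>k. 0 \<le> w k"
  defines "G \<equiv> {k. a \<le> k \<and> k < a + \<tau> * card (S \<inter> {..<k})}"
  shows "sum w (G \<inter> {..<n}) \<le> real \<tau> * sum w (S \<inter> {..<n})"
proof -
  let ?c = "\<lambda>n. real \<tau> * real (card (S \<inter> {..<n})) - real (card (G \<inter> {..<n}))"
  have Suc_S: "S \<inter> {..<Suc n} = (if n \<in> S then insert n (S \<inter> {..<n}) else S \<inter> {..<n})"
    and Suc_G: "G \<inter> {..<Suc n} = (if n \<in> G then insert n (G \<inter> {..<n}) else G \<inter> {..<n})" for n
    by (auto simp: less_Suc_eq)
  have card_G: "card (G \<inter> {..<n}) \<le> \<tau> * card (S \<inter> {..<n})" for n
  proof (induction n)
    case 0
    then show ?case by simp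
  next
    case (Suc n)
    have S_mono: "card (S \<inter> {..<n}) \<le> card (S \<inter> {..<Suc n})"
      by (intro card_mono) auto
    show ?case
    proof (cases "n \<in> G")
      case True
      have "card (G \<inter> {..<Suc n}) \<le> card {a..<Suc n}"
        by (intro card_mono) (auto simp: G_def)
      also have "\<dots> \<le> \<tau> * card (S \<inter> {..<n})"
        using True by (auto simp: G_def)
      also have "\<dots> \<le> \<tau> * card (S \<inter> {..<Suc n})"
        using S_mono by simp
      finally show ?thesis .
    next
      case False
      then have "card (G \<inter> {..<Suc n}) = card (G \<inter> {..<n})" by (simp add: Suc_G)
      also have "\<dots> \<le> \<tau> * card (S \<inter> {..<n})" by (rule Suc)
      also have "\<dots> \<le> \<tau> * card (S \<inter> {..<Suc n})" using S_mono by simp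
      finally show ?thesis .
    qed
  qed
  have c_nonneg: "0 \<le> ?c n" for n
    using card_G[of n] by (simp flip: of_nat_mult)
  have "?c n * w n \<le> real \<tau> * sum w (S \<inter> {..<n}) - sum w (G \<inter> {..<n})"
  proof (induction n)
    case 0
    then show ?case by simp
  next
    case (Suc n)
    have "?c (Suc n) * w (Suc n) \<le> ?c (Suc n) * w n"
      using w(1) c_nonneg by (intro mult_left_mono) (auto simp: antimono_def)
    also have "\<dots> = ?c n * w n + (if n \<in> S then real \<tau> * w n else 0) - (if n \<in> G then w n else 0)"
      by (simp add: Suc_S Suc_G algebra_simps)
    also have "\<dots> \<le> real \<tau> * sum w (S \<inter> {..<Suc n}) - sum w (G \<inter> {..<Suc n})"
      using Suc by (simp add: Suc_S Suc_G algebra_simps)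
    finally show ?case .
  qed
  moreover have "0 \<le> ?c n * w n" using c_nonneg w(2) by (rule mult_nonneg_nonneg)
  ultimately show ?thesis by simp
qed

text \<open>
  Replacing a factor \<open>b\<close> by the larger \<open>a\<close> increases the product, so the worst case is the largest
  admissible number of factors \<open>a\<close>, namely the fraction \<open>1 / \<tau>\<close> of the \<open>m\<close> factors.
\<close>
lemma geometric_product_le:
  fixes a b :: real and m S \<tau> :: nat
  assumes "0 < b" "b \<le> a" "0 < \<tau>" "\<tau> * S \<le> m"
  shows "a ^ S * b ^ (m - S) \<le> (a * b ^ (\<tau> - 1)) powr (real m / real \<tau>)"
proof -
  have S: "S \<le> m" using assms by (metis le_trans mult_le_mono1 Suc_leI nat_mult_1 One_nat_def)
  have "a ^ S * b ^ (m - S) = (a / b) powr real S * b powr real m"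
    using assms S by (simp add: powr_realpow power_divide power_diff)
  also have "\<dots> \<le> (a / b) powr (real m / real \<tau>) * b powr real m"
  proof (intro mult_right_mono powr_mono)
    show "real S \<le> real m / real \<tau>"
      using assms by (simp add: field_simps flip: of_nat_mult)
  qed (use assms in \<open>auto simp: field_simps\<close>)
  also have "b powr real m = (b powr real \<tau>) powr (real m / real \<tau>)"
    using assms by (simp add: powr_powr)
  also have "(a / b) powr (real m / real \<tau>) * \<dots> = (a / b * b powr real \<tau>) powr (real m / real \<tau>)"
    by (rule powr_mult[symmetric])
  also have "a / b * b powr real \<tau> = a * b ^ (\<tau> - 1)"
    using assms by (simp add: powr_realpow power_diff)
  finally show ?thesis .
qed

lemma summable_powr_div:
  fixes q :: real
  assumes "0 < q" "q < 1" "0 < \<tau>"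
  shows "summable (\<lambda>k. q powr (real k / real \<tau>))"
proof -
  have "q powr (real k / real \<tau>) = (q powr (1 / real \<tau>)) ^ k" for k
    using assms by (simp add: powr_powr flip: powr_realpow)
  moreover have "q powr (1 / real \<tau>) < 1"
    using assms powr_less_mono2[of "1 / real \<tau>" q 1] by simp
  ultimately show ?thesis by (simp add: summable_geometric)
qed

section \<open>The function psi\<close>
lemma psi_ge_one_plus:
  assumes "1 \<le> L" "0 \<le> b"
  shows "1 + b \<le> psi \<beta> L b"
  using assms mult_right_mono[of 1 L "1 + b"] by (auto simp: psi_def)

lemma psi_le_scaled:
  assumes "1 \<le> L" "0 \<le> x" "1 \<le> N" "b \<le> x * N"
  shows "psi \<beta> L b \<le> psi \<beta> L x * N"
proof (cases "\<beta> \<le> 1 / L")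
  case True
  have "L + b \<le> L * N + x * N" using assms mult_left_mono[of 1 N L] by linarith
  then show ?thesis using True assms by (simp add: psi_def distrib_right)
next
  case False
  have "1 + b \<le> (1 + x) * N" using assms by (simp add: algebra_simps)
  then show ?thesis using False assms by (simp add: psi_def mult.assoc)
qed

text \<open>
  The function \<open>psi\<close> is designed for this inequality.  For \<open>\<beta> \<le> 1 / L\<close> the quotient
  \<open>(1 + b) powr \<beta> / (L + b)\<close> itself decreases in \<open>b\<close>.  For larger \<open>\<beta>\<close> it need not, but its lower
  bound \<open>(1 + b) powr \<beta> / (L * (1 + b))\<close> does.
\<close>
lemma powr_over_psi_le:
  assumes L: "1 \<le> L" and \<beta>: "0 \<le> \<beta>" "\<beta> \<le> 1" and b: "0 \<le> b" "b \<le> M"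
  shows "(1 + M) powr \<beta> / psi \<beta> L M \<le> (1 + b) powr \<beta> / (L + b)"
proof (cases "\<beta> \<le> 1 / L")
  case True
  define u where "u = (M - b) / (1 + b)"
  have u: "0 \<le> u" "1 + M = (1 + b) * (1 + u)"
    using b by (auto simp: u_def field_simps)
  have "u * (1 + b) = M - b" using b by (simp add: u_def)
  have "\<beta> * (L + b) \<le> 1 + b"
  proof -
    have "\<beta> * L \<le> 1" using True L by (simp add: field_simps)
    moreover have "\<beta> * b \<le> 1 * b" using b \<beta> by (intro mult_right_mono) auto
    ultimately show ?thesis by (simp add: algebra_simps)
  qed
  then have "u * (\<beta> * (L + b)) \<le> u * (1 + b)" using u by (intro mult_left_mono) auto
  then have "(1 + \<beta> * u) * (L + b) \<le> L + M"
    using b \<open>u * (1 + b) = M - b\<close> by (simp add: algebra_simps)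
  then have *: "(1 + u) powr \<beta> * (L + b) \<le> L + M"
    using mult_right_mono[OF powr_Bernoulli[of u \<beta>], of "L + b"] u \<beta> L b by linarith
  have "(1 + M) powr \<beta> * (L + b) = (1 + b) powr \<beta> * ((1 + u) powr \<beta> * (L + b))"
    using u b by (simp add: powr_mult)
  also have "\<dots> \<le> (1 + b) powr \<beta> * (L + M)"
    using * by (intro mult_left_mono) auto
  finally show ?thesis using True L b by (simp add: psi_def divide_simps mult.commute)
next
  case False
  have "(1 + M) powr \<beta> / psi \<beta> L M = (1 + M) powr (\<beta> - 1) / L"
    using False L b by (simp add: psi_def powr_diff)
  also have "\<dots> \<le> (1 + b) powr (\<beta> - 1) / L"
    using L b \<beta> by (intro divide_right_mono powr_mono2') auto
  also have "\<dots> = (1 + b) powr \<beta> / (L * (1 + b))"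
    using L b by (simp add: powr_diff)
  also have "\<dots> \<le> (1 + b) powr \<beta> / (L + b)"
    using L b mult_right_mono[of 1 L b]
    by (intro divide_left_mono) (auto simp: algebra_simps intro!: mult_pos_pos add_pos_nonneg)
  finally show ?thesis .
qed

section \<open>Asymptotics of the bounds\<close>

text \<open>
  With \<open>y = ln (inverse \<epsilon>)\<close> both terms of the base are at most linear in \<open>y\<close>; the second is a power
  with exponent \<open>r \<le> 1\<close> of a linear function.  The condition on \<open>k4\<close> ensures that this linear
  function is nonnegative for small \<open>\<epsilon>\<close>, so that the power is monotone in it.
\<close>
lemma rate_bound_bigo:
  fixes C d0 K c k4 b r :: real
  assumes "0 \<le> C" "0 < d0" "0 \<le> K" "0 \<le> c" "c = 0 \<longrightarrow> 0 \<le> k4" "0 < b" "b < 1" "0 < r" "r \<le> 1"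
  shows "(\<lambda>\<epsilon>. (r * (C * ln (d0 / \<epsilon>) + K) + (c * log b \<epsilon> + k4) powr r) powr (1 / r))
           \<in> O[at_right 0](\<lambda>\<epsilon>. (r * ln (inverse \<epsilon>)) powr (1 / r))"
proof -
  define c' where "c' = c / (- ln b)"
  have lnb: "ln b < 0" using assms by simp
  have c': "0 \<le> c'" "c' = 0 \<longrightarrow> 0 \<le> k4" using assms lnb
    by (auto simp: c'_def simp del: ln_less_zero_iff intro: divide_nonneg_neg)
  define D where "D = C * (\<bar>ln d0\<bar> + 1) + K + (c' + \<bar>k4\<bar>) powr r / r"
  have D: "0 \<le> D" using assms c' by (auto simp: D_def)
  have lim: "filterlim (\<lambda>\<epsilon>. ln (inverse \<epsilon>) :: real) at_top (at_right 0)"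
    by (rule filterlim_compose[OF ln_at_top filterlim_inverse_at_top_right])
  have "\<forall>\<^sub>F \<epsilon> in at_right 0. 1 + \<bar>ln d0\<bar> + \<bar>k4\<bar> / c' \<le> ln (inverse \<epsilon>)"
    using lim by (simp add: filterlim_at_top)
  moreover have "\<forall>\<^sub>F \<epsilon> in at_right 0. (0::real) < \<epsilon>" by (rule eventually_at_right_less)
  ultimately have "\<forall>\<^sub>F \<epsilon> in at_right 0.
      norm ((r * (C * ln (d0 / \<epsilon>) + K) + (c * log b \<epsilon> + k4) powr r) powr (1 / r))
        \<le> D powr (1 / r) * norm ((r * ln (inverse \<epsilon>)) powr (1 / r))"
  proof eventually_elim
    case (elim \<epsilon>)
    define y where "y = ln (inverse \<epsilon>)"
    have frac: "0 \<le> \<bar>k4\<bar> / c'" using c' by simp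
    have y: "1 \<le> y" "\<bar>ln d0\<bar> \<le> y" "\<bar>k4\<bar> / c' \<le> y" using elim frac by (auto simp: y_def)
    have ln_eq: "ln (d0 / \<epsilon>) = ln d0 + y" using elim assms by (simp add: y_def ln_div ln_inverse)
    have log_eq: "c * log b \<epsilon> = c' * y"
      using elim by (simp add: y_def c'_def log_def ln_inverse)
    have cy: "0 \<le> c' * y + k4"
    proof (cases "c' = 0")
      case False
      then have "\<bar>k4\<bar> \<le> c' * y" using y(3) c'(1) by (simp add: field_simps)
      then show ?thesis by simp
    qed (use c' in simp)
    have "C * (ln d0 + y) \<le> C * ((\<bar>ln d0\<bar> + 1) * y)"
    proof (intro mult_left_mono)
      have "\<bar>ln d0\<bar> * 1 \<le> \<bar>ln d0\<bar> * y" using y by (intro mult_left_mono) auto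
      then show "ln d0 + y \<le> (\<bar>ln d0\<bar> + 1) * y" by (simp add: algebra_simps)
    qed (use assms in auto)
    moreover have "K * 1 \<le> K * y" using y assms by (intro mult_left_mono) auto
    ultimately have 1: "C * (ln d0 + y) + K \<le> (C * (\<bar>ln d0\<bar> + 1) + K) * y"
      by (simp add: algebra_simps)
    have "\<bar>k4\<bar> * 1 \<le> \<bar>k4\<bar> * y" using y by (intro mult_left_mono) auto
    then have "c' * y + k4 \<le> (c' + \<bar>k4\<bar>) * y" by (simp add: algebra_simps)
    then have "(c' * y + k4) powr r \<le> ((c' + \<bar>k4\<bar>) * y) powr r"
      using cy assms by (intro powr_mono2) auto
    also have "\<dots> = (c' + \<bar>k4\<bar>) powr r * y powr r" using c' y by (simp add: powr_mult)
    also have "\<dots> \<le> (c' + \<bar>k4\<bar>) powr r * y powr 1"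
      using y assms by (intro mult_left_mono powr_mono) auto
    finally have 2: "(c' * y + k4) powr r \<le> (c' + \<bar>k4\<bar>) powr r * y" using y by simp
    have "r * (C * (ln d0 + y) + K) + (c' * y + k4) powr r
        \<le> r * ((C * (\<bar>ln d0\<bar> + 1) + K) * y) + (c' + \<bar>k4\<bar>) powr r * y"
      using 1 2 assms by (intro add_mono mult_left_mono) auto
    also have "\<dots> = D * (r * y)" using assms by (simp add: D_def field_simps)
    finally have le: "r * (C * (ln d0 + y) + K) + (c' * y + k4) powr r \<le> D * (r * y)" .
    have "0 \<le> ln d0 + y" using y by linarith
    then have "0 \<le> C * (ln d0 + y)" using assms by (intro mult_nonneg_nonneg) auto
    then have "0 \<le> r * (C * (ln d0 + y) + K) + (c' * y + k4) powr r"
      using assms by (intro add_nonneg_nonneg mult_nonneg_nonneg[of r]) auto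
    with le have "(r * (C * (ln d0 + y) + K) + (c' * y + k4) powr r) powr (1 / r)
        \<le> (D * (r * y)) powr (1 / r)"
      using assms by (intro powr_mono2) auto
    also have "\<dots> = D powr (1 / r) * (r * y) powr (1 / r)"
      using D assms y by (simp add: powr_mult)
    finally show ?case by (simp add: ln_eq log_eq flip: y_def)
  qed
  then show ?thesis by (rule bigoI)
qed

lemma exp_ln_bound_bigo:
  fixes C d0 K :: real and h :: "real \<Rightarrow> real"
  assumes "0 < d0"
  shows "(\<lambda>\<epsilon>. h \<epsilon> * exp (C * ln (d0 / \<epsilon>) + K)) \<in> O[at_right 0](\<lambda>\<epsilon>. h \<epsilon> * \<epsilon> powr (- C))"
proof (rule bigoI)
  have "\<forall>\<^sub>F \<epsilon> in at_right 0. (0::real) < \<epsilon>" by (rule eventually_at_right_less)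
  then show "\<forall>\<^sub>F \<epsilon> in at_right 0. norm (h \<epsilon> * exp (C * ln (d0 / \<epsilon>) + K))
      \<le> exp (C * ln d0 + K) * norm (h \<epsilon> * \<epsilon> powr (- C))"
  proof eventually_elim
    case (elim \<epsilon>)
    have "exp (C * ln (d0 / \<epsilon>) + K) = exp (C * ln d0 + K) * \<epsilon> powr (- C)"
      using elim assms by (simp add: ln_div powr_def algebra_simps flip: exp_add)
    then show ?case by (simp add: abs_mult)
  qed
qed

section \<open>The Cauchy point\<close>
lemma opnorm_nonneg: "0 \<le> opnorm (A :: real^'n^'n)"
  unfolding opnorm_def by (rule onorm_pos_le) (rule matrix_vector_mul_bounded_linear)

lemma quadratic_form_le: "v \<bullet> (A *v v) \<le> opnorm A * (norm v)\<^sup>2" for A :: "real^'n^'n"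
proof -
  have "v \<bullet> (A *v v) \<le> norm v * norm (A *v v)" by (rule norm_cauchy_schwarz)
  also have "\<dots> \<le> norm v * (opnorm A * norm v)"
    unfolding opnorm_def
    by (intro mult_left_mono onorm matrix_vector_mul_bounded_linear) auto
  finally show ?thesis by (simp add: power2_eq_square mult_ac)
qed

text \<open>
  The Cauchy point is at least as good as the point at distance \<open>v\<close> along the steepest descent
  direction.  As long as \<open>v\<close> does not exceed \<open>norm (g y) / opnorm A\<close>, the quadratic term takes back at
  most half of the linear decrease \<open>v * norm (g y)\<close>.
\<close>
lemma cauchy_decrease:
  assumes cp: "cauchy_stepsize f g y A r u"
    and v: "0 \<le> v" "v \<le> r" "opnorm A * v \<le> norm (g y)"
  shows "v * norm (g y) / 2 \<le> tr_model f g y A 0 - tr_model f g y A (- (u *\<^sub>R g y))"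
proof (cases "g y = 0")
  case True
  then show ?thesis by simp
next
  case False
  define w where "w = v / norm (g y)"
  have w: "norm (w *\<^sub>R g y) = v" "0 \<le> w" using False v by (auto simp: w_def)
  have "tr_model f g y A (- (u *\<^sub>R g y)) \<le> tr_model f g y A (- (w *\<^sub>R g y))"
    using cp w v unfolding cauchy_stepsize_def is_arg_min_def by (metis linorder_not_less)
  also have "\<dots> = f y - v * norm (g y) + 1/2 * (- (w *\<^sub>R g y) \<bullet> (A *v - (w *\<^sub>R g y)))"
    using False by (simp add: tr_model_def w_def power2_norm_eq_inner[symmetric] power2_eq_square)
  also have "- (w *\<^sub>R g y) \<bullet> (A *v - (w *\<^sub>R g y)) \<le> opnorm A * v\<^sup>2"
    using quadratic_form_le[of "- (w *\<^sub>R g y)" A] w by simp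
  also have "opnorm A * v\<^sup>2 = (opnorm A * v) * v" by (simp add: power2_eq_square)
  also have "\<dots> \<le> norm (g y) * v" using v by (intro mult_right_mono) auto
  finally show ?thesis by (simp add: tr_model_def algebra_simps)
qed

section \<open>Radius and decrease along a run\<close>
locale trust_region =
  fixes f :: "real^'n \<Rightarrow> real" and g :: "real^'n \<Rightarrow> real^'n"
    and x\<^sub>0 :: "real^'n" and x s :: "nat \<Rightarrow> real^'n" and B :: "nat \<Rightarrow> real^'n^'n"
    and t \<Delta> :: "nat \<Rightarrow> real"
    and \<eta>\<^sub>1 \<eta>\<^sub>2 \<gamma>\<^sub>1 \<gamma>\<^sub>2 \<gamma>\<^sub>3 \<gamma>\<^sub>4 \<kappa>mdc \<alpha> \<beta> \<Delta>\<^sub>0 L amin :: real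
  assumes \<eta>: "0 < \<eta>\<^sub>1" "\<eta>\<^sub>1 \<le> \<eta>\<^sub>2" "\<eta>\<^sub>2 < 1"
    and \<gamma>: "0 < \<gamma>\<^sub>1" "\<gamma>\<^sub>1 \<le> \<gamma>\<^sub>2" "\<gamma>\<^sub>2 < 1" "1 \<le> \<gamma>\<^sub>3" "\<gamma>\<^sub>3 \<le> \<gamma>\<^sub>4"
    and \<kappa>mdc: "0 < \<kappa>mdc" "\<kappa>mdc \<le> 1/2"
    and \<alpha>: "-1 \<le> \<alpha>" "\<alpha> \<le> 1" and \<beta>: "0 \<le> \<beta>" "\<beta> \<le> 1" and \<Delta>\<^sub>0: "0 < \<Delta>\<^sub>0"
    and run: "trust_region_run \<eta>\<^sub>1 \<eta>\<^sub>2 \<gamma>\<^sub>1 \<gamma>\<^sub>2 \<gamma>\<^sub>3 \<gamma>\<^sub>4 \<kappa>mdc \<alpha> \<beta> f g x\<^sub>0 \<Delta>\<^sub>0 x B t s \<Delta>"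
    and L: "1 \<le> L"
    and model_error: "\<And>k. \<bar>f (x k + s k) - tr_model f g (x k) (B k) (s k)\<bar>
                            \<le> 1/2 * (L + opnorm (B k)) * (norm (s k))\<^sup>2"
    and amin: "amin = 2 * \<gamma>\<^sub>1 * \<kappa>mdc * (1 - \<eta>\<^sub>2) * min 1 (\<Delta>\<^sub>0 / rpow (norm (g x\<^sub>0)) (1 - \<alpha>))"
begin

abbreviation ratio :: "nat \<Rightarrow> real" where
  "ratio k \<equiv> tr_ratio f g (x k) (B k) (s k)"

abbreviation radius :: "nat \<Rightarrow> real" where
  "radius k \<equiv> tr_radius \<alpha> \<beta> g (x k) (B k) (\<Delta> k)"

abbreviation model_decrease :: "nat \<Rightarrow> real" where
  "model_decrease k \<equiv> tr_model f g (x k) (B k) 0 - tr_model f g (x k) (B k) (s k)"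

abbreviation successes :: "nat set" where
  "successes \<equiv> {k. \<eta>\<^sub>1 \<le> ratio k}"

lemma start: "x 0 = x\<^sub>0" "\<Delta> 0 = \<Delta>\<^sub>0"
  using run by (auto simp: trust_region_run_def)

lemma run_step:
  shows cauchy: "cauchy_stepsize f g (x k) (B k) (radius k) (t k)"
    and norm_step: "norm (s k) \<le> radius k"
    and sufficient_decrease: "2 * \<kappa>mdc * (tr_model f g (x k) (B k) 0
          - tr_model f g (x k) (B k) (- (t k *\<^sub>R g (x k)))) \<le> model_decrease k"
    and next_iterate: "x (Suc k) = (if \<eta>\<^sub>1 \<le> ratio k then x k + s k else x k)"
    and radius_increase: "\<eta>\<^sub>2 \<le> ratio k \<Longrightarrow> \<Delta> (Suc k) \<in> {\<gamma>\<^sub>3 * \<Delta> k .. \<gamma>\<^sub>4 * \<Delta> k}"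
    and radius_moderate: "\<eta>\<^sub>1 \<le> ratio k \<Longrightarrow> ratio k < \<eta>\<^sub>2 \<Longrightarrow> \<Delta> (Suc k) \<in> {\<gamma>\<^sub>2 * \<Delta> k .. \<Delta> k}"
    and radius_decrease: "ratio k < \<eta>\<^sub>1 \<Longrightarrow> \<Delta> (Suc k) \<in> {\<gamma>\<^sub>1 * \<Delta> k .. \<gamma>\<^sub>2 * \<Delta> k}"
  using run unfolding trust_region_run_def Let_def by blast+

lemma model_decrease_ge:
  assumes "0 \<le> v" "v \<le> radius k" "opnorm (B k) * v \<le> norm (g (x k))"
  shows "\<kappa>mdc * v * norm (g (x k)) \<le> model_decrease k"
proof -
  have "\<kappa>mdc * v * norm (g (x k)) = 2 * \<kappa>mdc * (v * norm (g (x k)) / 2)" by simp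
  also have "\<dots> \<le> model_decrease k"
    using cauchy_decrease[OF cauchy assms] \<kappa>mdc
    by (intro order_trans[OF mult_left_mono sufficient_decrease]) auto
  finally show ?thesis .
qed

lemma radius_nonneg: "0 \<le> radius k"
  using norm_step[of k] norm_ge_zero order_trans by blast

lemma model_decrease_nonneg: "0 \<le> model_decrease k"
  using model_decrease_ge[of 0 k] radius_nonneg by simp

lemma objective_decrease:
  assumes "k \<in> successes"
  shows "\<eta>\<^sub>1 * model_decrease k \<le> f (x k) - f (x (Suc k))" and "f (x (Suc k)) < f (x k)"
proof -
  have ratio: "\<eta>\<^sub>1 \<le> (f (x k) - f (x k + s k)) / model_decrease k"
    using assms by (simp add: tr_ratio_def)
  \<comment> \<open>A vanishing model decrease would make the ratio zero, hence the iteration unsuccessful.\<close>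
  have pos: "0 < model_decrease k"
    using ratio \<eta>(1) model_decrease_nonneg[of k] by (cases "model_decrease k = 0") auto
  then show dec: "\<eta>\<^sub>1 * model_decrease k \<le> f (x k) - f (x (Suc k))"
    using ratio assms by (simp add: next_iterate pos_le_divide_eq)
  show "f (x (Suc k)) < f (x k)" using dec mult_pos_pos[OF \<eta>(1) pos] by linarith
qed

lemma objective_antimono: "antimono (\<lambda>k. f (x k))"
proof (rule decseq_SucI)
  show "f (x (Suc k)) \<le> f (x k)" for k
    using objective_decrease(2)[of k] by (cases "k \<in> successes") (auto simp: next_iterate)
qed

lemma \<Delta>_pos: "0 < \<Delta> k"
proof (induction k)
  case 0
  then show ?case using \<Delta>\<^sub>0 by (simp add: start)
next
  case (Suc k)
  then have "0 < \<gamma>\<^sub>1 * \<Delta> k" "0 < \<gamma>\<^sub>2 * \<Delta> k" "0 < \<gamma>\<^sub>3 * \<Delta> k" using \<gamma> by auto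
  then show ?case
    using radius_increase[of k] radius_moderate[of k] radius_decrease[of k] by fastforce
qed

lemma radius_eq:
  assumes "g (x k) \<noteq> 0"
  shows "radius k = norm (g (x k)) powr \<alpha> * \<Delta> k / (1 + opnorm (B k)) powr \<beta>"
  using assms opnorm_nonneg[of "B k"] by (simp add: tr_radius_def rpow_def)

text \<open>
  A small enough radius keeps the model error \<open>1/2 * (L + opnorm (B k)) * (norm (s k))\<^sup>2\<close> below the
  fraction \<open>1 - \<eta>\<^sub>2\<close> of the model decrease, which is at least \<open>\<kappa>mdc * radius k * norm (g (x k))\<close>
  because the radius is then also too short for the curvature to matter.
\<close>
lemma very_successful:
  assumes grad: "g (x k) \<noteq> 0"
    and small: "\<Delta> k \<le> 2 * \<kappa>mdc * (1 - \<eta>\<^sub>2) * norm (g (x k)) powr (1 - \<alpha>)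
                  * ((1 + opnorm (B k)) powr \<beta> / (L + opnorm (B k)))"
  shows "\<eta>\<^sub>2 \<le> ratio k"
proof -
  let ?b = "opnorm (B k)" and ?r = "radius k" and ?g = "norm (g (x k))"
  have b: "0 \<le> ?b" by (rule opnorm_nonneg)
  have g_pos: "0 < ?g" using grad by simp
  have Lb: "0 < L + ?b" using L b by simp
  have r_pos: "0 < ?r"
    unfolding radius_eq[OF grad] using grad b \<Delta>_pos[of k] by simp
  have "?r \<le> ?g powr \<alpha> * (2 * \<kappa>mdc * (1 - \<eta>\<^sub>2) * ?g powr (1 - \<alpha>)
                  * ((1 + ?b) powr \<beta> / (L + ?b))) / (1 + ?b) powr \<beta>"
    unfolding radius_eq[OF grad] by (intro divide_right_mono mult_left_mono small) auto
  also have "\<dots> = 2 * \<kappa>mdc * (1 - \<eta>\<^sub>2) * (?g powr \<alpha> * ?g powr (1 - \<alpha>)) / (L + ?b)"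
    using b by (simp add: mult_ac)
  also have "?g powr \<alpha> * ?g powr (1 - \<alpha>) = ?g"
    using grad by (simp flip: powr_add)
  finally have r_le: "(L + ?b) * ?r \<le> 2 * \<kappa>mdc * (1 - \<eta>\<^sub>2) * ?g"
    using Lb by (simp add: pos_le_divide_eq mult.commute)
  have "2 * \<kappa>mdc * (1 - \<eta>\<^sub>2) \<le> 1"
    using \<kappa>mdc \<eta> mult_mono[of "2 * \<kappa>mdc" 1 "1 - \<eta>\<^sub>2" 1] by simp
  then have "2 * \<kappa>mdc * (1 - \<eta>\<^sub>2) * ?g \<le> ?g" using g_pos by simp
  moreover have "?b * ?r \<le> (L + ?b) * ?r" using L r_pos by (intro mult_right_mono) auto
  ultimately have "?b * ?r \<le> ?g" using r_le by linarith
  then have md: "\<kappa>mdc * ?r * ?g \<le> model_decrease k"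
    using r_pos by (intro model_decrease_ge) auto
  have "tr_model f g (x k) (B k) 0 = f (x k)" by (simp add: tr_model_def)
  then have "f (x k + s k) - f (x k) + model_decrease k
      \<le> 1/2 * (L + ?b) * (norm (s k))\<^sup>2"
    using model_error[of k] by linarith
  also have "\<dots> \<le> 1/2 * (L + ?b) * ?r\<^sup>2"
    using norm_step[of k] Lb by (intro mult_left_mono power_mono) auto
  also have "\<dots> = 1/2 * ((L + ?b) * ?r) * ?r" by (simp add: power2_eq_square)
  also have "\<dots> \<le> 1/2 * (2 * \<kappa>mdc * (1 - \<eta>\<^sub>2) * ?g) * ?r"
    using r_le r_pos by (intro mult_right_mono mult_left_mono) auto
  also have "\<dots> = (1 - \<eta>\<^sub>2) * (\<kappa>mdc * ?r * ?g)" by simp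
  also have "\<dots> \<le> (1 - \<eta>\<^sub>2) * model_decrease k"
    using md \<eta> by (intro mult_left_mono) auto
  finally have "\<eta>\<^sub>2 * model_decrease k \<le> f (x k) - f (x k + s k)"
    by (simp add: algebra_simps)
  moreover have "0 < model_decrease k"
    using md \<kappa>mdc r_pos g_pos by (meson less_le_trans mult_pos_pos)
  ultimately show ?thesis by (simp add: tr_ratio_def pos_le_divide_eq)
qed

lemma amin_bounds:
  assumes "g x\<^sub>0 \<noteq> 0"
  shows "0 < amin" "amin < 1" "amin * norm (g x\<^sub>0) powr (1 - \<alpha>) < \<Delta>\<^sub>0"
    "amin \<le> 2 * \<gamma>\<^sub>1 * \<kappa>mdc * (1 - \<eta>\<^sub>2)"
proof -
  let ?N = "norm (g x\<^sub>0) powr (1 - \<alpha>)"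
  let ?c = "2 * \<gamma>\<^sub>1 * \<kappa>mdc * (1 - \<eta>\<^sub>2)"
  have N: "0 < ?N" using assms by simp
  have eq: "amin = ?c * min 1 (\<Delta>\<^sub>0 / ?N)" using assms by (simp add: amin rpow_def)
  have c: "0 < ?c" using \<eta> \<gamma> \<kappa>mdc by simp
  have "?c = (2 * \<kappa>mdc) * (1 - \<eta>\<^sub>2) * \<gamma>\<^sub>1" by simp
  also have "\<dots> \<le> 1 * 1 * \<gamma>\<^sub>1" using \<eta> \<gamma> \<kappa>mdc by (intro mult_mono) auto
  finally have "?c \<le> \<gamma>\<^sub>1" by (simp only: mult_1)
  then have c1: "?c < 1" using \<gamma> by linarith
  have m: "0 < min 1 (\<Delta>\<^sub>0 / ?N)" "min 1 (\<Delta>\<^sub>0 / ?N) \<le> 1" using N \<Delta>\<^sub>0 by auto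
  show "0 < amin" using c m(1) unfolding eq by (rule mult_pos_pos)
  show *: "amin \<le> ?c" using mult_left_mono[OF m(2), of ?c] c by (simp add: eq)
  then show "amin < 1" using c1 by linarith
  have "min 1 (\<Delta>\<^sub>0 / ?N) * ?N \<le> \<Delta>\<^sub>0 / ?N * ?N" using N by (intro mult_right_mono) auto
  also have "\<dots> = \<Delta>\<^sub>0" using N by simp
  finally have "?c * (min 1 (\<Delta>\<^sub>0 / ?N) * ?N) \<le> ?c * \<Delta>\<^sub>0" using c by (intro mult_left_mono) auto
  also have "\<dots> < 1 * \<Delta>\<^sub>0" using c1 \<Delta>\<^sub>0 by (intro mult_strict_right_mono)
  finally show "amin * ?N < \<Delta>\<^sub>0" by (simp add: eq mult.assoc)
qed

text \<open>
  The parameter only shrinks at iterations that are not very successful; there it exceeds the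
  threshold of \<open>very_successful\<close>, and it loses at most the factor \<open>\<gamma>\<^sub>1\<close>, which is part of \<open>amin\<close>.
  The minimum in \<open>amin\<close> takes care of the initial value.  Arbitrary bounds \<open>G\<close> and \<open>M\<close>, in place of
  the minimum of the gradient norms and the maximum of the Hessian norms up to \<open>k\<close>, stay the same
  throughout the induction.
\<close>
lemma \<Delta>_lower_bound:
  assumes G: "0 < G" and "\<And>j. j \<le> k \<Longrightarrow> G \<le> norm (g (x j))"
    and "\<And>j. j \<le> k \<Longrightarrow> opnorm (B j) \<le> M"
  shows "amin * G powr (1 - \<alpha>) * ((1 + M) powr \<beta> / psi \<beta> L M) \<le> \<Delta> k"
  using assms(2,3)
proof (induction k)
  case 0
  have M: "0 \<le> M" using 0(2)[of 0] opnorm_nonneg[of "B 0"] by simp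
  have G0: "G \<le> norm (g x\<^sub>0)" using 0(1)[of 0] by (simp add: start)
  then have g0: "g x\<^sub>0 \<noteq> 0" using G by auto
  have "(1 + M) powr \<beta> \<le> (1 + M) powr 1" using M \<beta> by (intro powr_mono) auto
  then have "(1 + M) powr \<beta> / psi \<beta> L M \<le> 1"
    using M psi_ge_one_plus[OF L M, of \<beta>] by (simp add: divide_le_eq_1)
  moreover have "amin * G powr (1 - \<alpha>) \<le> amin * norm (g x\<^sub>0) powr (1 - \<alpha>)"
    using amin_bounds[OF g0] G G0 \<alpha> by (intro mult_left_mono powr_mono2) auto
  then have "amin * G powr (1 - \<alpha>) \<le> \<Delta>\<^sub>0" using amin_bounds(3)[OF g0] by linarith
  moreover have "0 \<le> amin * G powr (1 - \<alpha>)" using amin_bounds[OF g0] by simp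
  ultimately have "amin * G powr (1 - \<alpha>) * ((1 + M) powr \<beta> / psi \<beta> L M) \<le> \<Delta>\<^sub>0 * 1"
    using M psi_ge_one_plus[OF L M, of \<beta>] \<Delta>\<^sub>0 by (intro mult_mono) auto
  then show ?case by (simp add: start)
next
  case (Suc k)
  let ?target = "amin * G powr (1 - \<alpha>) * ((1 + M) powr \<beta> / psi \<beta> L M)"
  have IH: "?target \<le> \<Delta> k" using Suc by simp
  have Gk: "G \<le> norm (g (x k))" and bM: "opnorm (B k) \<le> M" using Suc.prems by auto
  have gk: "g (x k) \<noteq> 0" using G Gk by auto
  have g0: "g x\<^sub>0 \<noteq> 0" using Suc.prems(1)[of 0] G by (auto simp: start)
  have b: "0 \<le> opnorm (B k)" by (rule opnorm_nonneg)
  show ?case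
  proof (cases "\<eta>\<^sub>2 \<le> ratio k")
    case True
    then have "\<gamma>\<^sub>3 * \<Delta> k \<le> \<Delta> (Suc k)" using radius_increase by simp
    moreover have "\<Delta> k \<le> \<gamma>\<^sub>3 * \<Delta> k" using \<gamma> \<Delta>_pos[of k] by simp
    ultimately show ?thesis using IH by linarith
  next
    case False
    have "\<gamma>\<^sub>1 * \<Delta> k \<le> \<gamma>\<^sub>2 * \<Delta> k" using \<gamma> \<Delta>_pos[of k] by simp
    then have shrink: "\<gamma>\<^sub>1 * \<Delta> k \<le> \<Delta> (Suc k)"
      using False radius_moderate[of k] radius_decrease[of k] by (cases "\<eta>\<^sub>1 \<le> ratio k") auto
    have lower: "2 * \<kappa>mdc * (1 - \<eta>\<^sub>2) * norm (g (x k)) powr (1 - \<alpha>)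
            * ((1 + opnorm (B k)) powr \<beta> / (L + opnorm (B k))) \<le> \<Delta> k"
      using very_successful[OF gk] False by (metis linorder_le_cases)
    have "?target \<le> (2 * \<gamma>\<^sub>1 * \<kappa>mdc * (1 - \<eta>\<^sub>2)) * norm (g (x k)) powr (1 - \<alpha>)
            * ((1 + opnorm (B k)) powr \<beta> / (L + opnorm (B k)))"
      using G Gk \<alpha> \<eta> \<gamma> \<kappa>mdc b bM amin_bounds[OF g0] psi_ge_one_plus[OF L, of M \<beta>]
      by (intro mult_mono powr_mono2 powr_over_psi_le L \<beta>) auto
    also have "\<dots> = \<gamma>\<^sub>1 * (2 * \<kappa>mdc * (1 - \<eta>\<^sub>2) * norm (g (x k)) powr (1 - \<alpha>)
            * ((1 + opnorm (B k)) powr \<beta> / (L + opnorm (B k))))"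
      by simp
    also have "\<dots> \<le> \<gamma>\<^sub>1 * \<Delta> k"
      using \<gamma> by (intro mult_left_mono[OF lower]) auto
    finally show ?thesis using shrink by linarith
  qed
qed

text \<open>
  A success enlarges the parameter by at most the factor \<open>\<gamma>\<^sub>4\<close>, a failure shrinks it by at least the
  factor \<open>\<gamma>\<^sub>2\<close>.
\<close>
lemma \<Delta>_upper_bound:
  defines "S \<equiv> \<lambda>k. card (successes \<inter> {..<k})"
  shows "\<Delta> k \<le> \<Delta>\<^sub>0 * \<gamma>\<^sub>4 ^ S k * \<gamma>\<^sub>2 ^ (k - S k)"
proof (induction k)
  case 0
  then show ?case by (simp add: S_def start)
next
  case (Suc k)
  have S_le: "S k \<le> k"
    using card_mono[of "{..<k}" "successes \<inter> {..<k}"] by (simp add: S_def)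
  have pos: "0 < \<gamma>\<^sub>2" "0 < \<gamma>\<^sub>4" using \<gamma> by auto
  show ?case
  proof (cases "k \<in> successes")
    case True
    then have S: "S (Suc k) = Suc (S k)"
      by (simp add: S_def lessThan_Suc Int_insert_right)
    have "\<Delta> k \<le> \<gamma>\<^sub>4 * \<Delta> k" using \<gamma> \<Delta>_pos[of k] by simp
    then have "\<Delta> (Suc k) \<le> \<gamma>\<^sub>4 * \<Delta> k"
      using True radius_increase[of k] radius_moderate[of k] by (cases "\<eta>\<^sub>2 \<le> ratio k") auto
    also have "\<dots> \<le> \<gamma>\<^sub>4 * (\<Delta>\<^sub>0 * \<gamma>\<^sub>4 ^ S k * \<gamma>\<^sub>2 ^ (k - S k))"
      using Suc pos by (intro mult_left_mono) auto
    finally show ?thesis by (simp add: S mult_ac)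
  next
    case False
    then have S: "S (Suc k) = S k"
      by (simp add: S_def lessThan_Suc Int_insert_right)
    have "\<Delta> (Suc k) \<le> \<gamma>\<^sub>2 * \<Delta> k" using False radius_decrease[of k] by simp
    also have "\<dots> \<le> \<gamma>\<^sub>2 * (\<Delta>\<^sub>0 * \<gamma>\<^sub>4 ^ S k * \<gamma>\<^sub>2 ^ (k - S k))"
      using Suc pos by (intro mult_left_mono) auto
    finally show ?thesis using S_le by (simp add: S Suc_diff_le mult_ac)
  qed
qed

end

section \<open>Gradient domination and growing Hessians\<close>

text \<open>
  The logarithmic decrease of the gap rests on the Polyak-Lojasiewicz inequality
  \<open>gradient_dominates\<close>, which strong convexity implies.
\<close>
locale gradient_dominated_trust_region = trust_region +
  fixes flow \<mu>c \<mu> p :: real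
  assumes \<mu>c: "0 < \<mu>c" and flow: "\<And>y. flow \<le> f y"
    and gradient_dominates: "\<And>y. 2 * \<mu>c * (f y - flow) \<le> (norm (g y))\<^sup>2"
    and \<mu>: "0 < \<mu>" and p: "0 < p"
    and hessian_growth: "\<And>j k. j \<le> k \<Longrightarrow> opnorm (B j) \<le> \<mu> * (1 + real k powr p)"
    and infinite_successes: "infinite successes"
begin

abbreviation gap :: "nat \<Rightarrow> real" where
  "gap k \<equiv> f (x k) - flow"

text \<open>
  The cutoff at \<open>1\<close> gives iteration \<open>0\<close> the weight \<open>1\<close>, so that \<open>2 * \<mu> / weight k\<close> bounds the
  Hessians for every \<open>k\<close>, including \<open>0\<close>, and the weights decrease from the start.
\<close>
definition weight :: "nat \<Rightarrow> real" where
  "weight k = real (max 1 k) powr (- p)"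

lemma weight_pos: "0 < weight k"
  by (simp add: weight_def)

lemma weight_le_1: "weight k \<le> 1"
  using p powr_mono[of "- p" 0 "real (max 1 k)"] by (simp add: weight_def)

lemma weight_antimono: "antimono weight"
  using p by (auto simp: antimono_def weight_def intro!: powr_mono2')

text \<open>
  Each success decreases \<open>f\<close> strictly, and one always lies ahead, so no iterate is a minimizer.
\<close>
lemma gap_pos: "0 < gap k"
proof -
  obtain n where n: "k \<le> n" "n \<in> successes"
    using infinite_successes by (metis infinite_nat_iff_unbounded_le)
  have "flow \<le> f (x (Suc n))" by (rule flow)
  also have "\<dots> < f (x n)" using objective_decrease(2) n by blast
  also have "\<dots> \<le> f (x k)" using objective_antimono n by (auto simp: antimono_def)
  finally show ?thesis by simp
qed

lemma gap_antimono: "j \<le> k \<Longrightarrow> gap k \<le> gap j"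
  using objective_antimono by (auto simp: antimono_def)

lemma gradient_ge:
  assumes "j \<le> k"
  shows "sqrt (2 * \<mu>c * gap k) \<le> norm (g (x j))"
proof (rule real_le_lsqrt)
  have "2 * \<mu>c * gap k \<le> 2 * \<mu>c * gap j"
    using gap_antimono[OF assms] \<mu>c by (intro mult_left_mono) auto
  also have "\<dots> \<le> (norm (g (x j)))\<^sup>2" by (rule gradient_dominates)
  finally show "2 * \<mu>c * gap k \<le> (norm (g (x j)))\<^sup>2" .
qed simp

lemma gradient_nonzero: "g (x k) \<noteq> 0"
proof -
  have "0 < sqrt (2 * \<mu>c * gap k)" using gap_pos[of k] \<mu>c by simp
  also have "\<dots> \<le> norm (g (x k))" by (rule gradient_ge) simp
  finally show ?thesis by simp
qed

lemma gradient_start_nonzero: "g x\<^sub>0 \<noteq> 0"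
  using gradient_nonzero[of 0] by (simp add: start)

lemmas amin_facts = amin_bounds[OF gradient_start_nonzero]

lemma hessian_le:
  assumes "j \<le> k"
  shows "opnorm (B j) \<le> 2 * \<mu> / weight k"
proof -
  have "1 + real k powr p \<le> 2 * real (max 1 k) powr p"
    using p ge_one_powr_ge_zero[of "real k" p] by (cases "k = 0") (auto simp: max_def)
  then have "\<mu> * (1 + real k powr p) \<le> \<mu> * (2 * real (max 1 k) powr p)"
    using \<mu> by (intro mult_left_mono) auto
  then show ?thesis
    using hessian_growth[OF assms] by (simp add: weight_def powr_minus field_simps)
qed

lemma psi_pos: "0 < psi \<beta> L (2 * \<mu>)"
  using psi_ge_one_plus[OF L, of "2 * \<mu>" \<beta>] \<mu> by simp

lemma psi_hessian_le: "psi \<beta> L (2 * \<mu> / weight k) \<le> psi \<beta> L (2 * \<mu>) / weight k"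
  using psi_le_scaled[OF L, of "2 * \<mu>" "1 / weight k" "2 * \<mu> / weight k" \<beta>] \<mu>
    weight_pos[of k] weight_le_1[of k] by (simp add: field_simps)

lemma \<Delta>_ge:
  "amin * sqrt (2 * \<mu>c * gap k) powr (1 - \<alpha>)
     * ((1 + 2 * \<mu> / weight k) powr \<beta> / psi \<beta> L (2 * \<mu> / weight k)) \<le> \<Delta> k"
  using gradient_ge hessian_le gap_pos[of k] \<mu>c by (intro \<Delta>_lower_bound) auto

text \<open>
  The trial length \<open>v = amin * G\<^sup>2 / (norm (g (x k)) * P)\<close> fits into the trust region by the lower
  bound on the radius parameter, and satisfies the curvature restriction of \<open>model_decrease_ge\<close>
  because \<open>amin < 1\<close> and \<open>P\<close> exceeds the Hessian norm.  Its decrease no longer contains the current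
  gradient norm.
\<close>
lemma success_decrease:
  assumes k: "k \<in> successes"
  shows "2 * \<mu>c * (\<eta>\<^sub>1 * \<kappa>mdc * amin / psi \<beta> L (2 * \<mu>)) * weight k * gap k
           \<le> gap k - gap (Suc k)"
proof -
  define G where "G = sqrt (2 * \<mu>c * gap k)"
  define M where "M = 2 * \<mu> / weight k"
  define P where "P = psi \<beta> L M"
  define n where "n = norm (g (x k))"
  define b where "b = opnorm (B k)"
  have G: "0 < G" "G\<^sup>2 = 2 * \<mu>c * gap k" using gap_pos[of k] \<mu>c by (auto simp: G_def)
  have Gn: "G \<le> n" unfolding G_def n_def by (rule gradient_ge) simp
  have n: "0 < n" using G Gn by linarith
  have b: "0 \<le> b" "b \<le> M" using opnorm_nonneg hessian_le[of k k] by (auto simp: b_def M_def)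
  have P: "1 + M \<le> P" using psi_ge_one_plus[OF L] b unfolding P_def by fastforce
  then have P_pos: "0 < P" using b by linarith
  have \<Delta>: "amin * G powr (1 - \<alpha>) * ((1 + M) powr \<beta> / P) \<le> \<Delta> k"
    unfolding G_def M_def P_def by (rule \<Delta>_ge)
  \<comment> \<open>The exponent \<open>1 + \<alpha>\<close> is nonnegative, which lets \<open>G\<close> replace the current gradient norm.\<close>
  have "G\<^sup>2 = G powr (1 + \<alpha>) * G powr (1 - \<alpha>)" using G by (simp flip: powr_add)
  also have "\<dots> \<le> n powr (1 + \<alpha>) * G powr (1 - \<alpha>)"
    using G Gn \<alpha> by (intro mult_right_mono powr_mono2) auto
  also have "n powr (1 + \<alpha>) = n powr \<alpha> * n" using n by (simp add: powr_add mult.commute)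
  finally have G2: "G\<^sup>2 / n \<le> n powr \<alpha> * G powr (1 - \<alpha>)"
    using n by (simp add: field_simps)
  define v where "v = amin * (G\<^sup>2 / n) / P"
  have v: "0 \<le> v" using amin_facts P_pos n by (simp add: v_def)
  have "v \<le> amin * (n powr \<alpha> * G powr (1 - \<alpha>)) / P"
    unfolding v_def using G2 amin_facts P_pos by (intro divide_right_mono mult_left_mono) auto
  also have "\<dots> = n powr \<alpha> * (amin * G powr (1 - \<alpha>) * ((1 + b) powr \<beta> / P)) / (1 + b) powr \<beta>"
    using b by simp
  also have "\<dots> \<le> n powr \<alpha> * (amin * G powr (1 - \<alpha>) * ((1 + M) powr \<beta> / P)) / (1 + b) powr \<beta>"
    using b \<beta> amin_facts P_pos
    by (intro divide_right_mono mult_left_mono powr_mono2) auto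
  also have "\<dots> \<le> n powr \<alpha> * \<Delta> k / (1 + b) powr \<beta>"
    using \<Delta> by (intro divide_right_mono mult_left_mono) auto
  also have "\<dots> = radius k" by (simp add: radius_eq gradient_nonzero n_def b_def)
  finally have v_radius: "v \<le> radius k" .
  have "b * v = (b / P) * amin * (G\<^sup>2 / n)" by (simp add: v_def mult_ac)
  also have "\<dots> \<le> 1 * 1 * (n\<^sup>2 / n)"
    using b P P_pos amin_facts G(1) Gn n
    by (intro mult_mono divide_right_mono power_mono) auto
  also have "\<dots> = n" using n by (simp add: power2_eq_square)
  finally have "\<kappa>mdc * v * n \<le> model_decrease k"
    using model_decrease_ge[OF v v_radius] by (simp add: n_def b_def)
  then have "\<eta>\<^sub>1 * (\<kappa>mdc * v * n) \<le> \<eta>\<^sub>1 * model_decrease k" using \<eta> by (intro mult_left_mono) auto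
  also have "\<dots> \<le> gap k - gap (Suc k)" using objective_decrease(1)[OF k] by simp
  finally have dec: "\<eta>\<^sub>1 * \<kappa>mdc * amin * G\<^sup>2 / P \<le> gap k - gap (Suc k)"
    using n by (simp add: v_def mult_ac)
  have "\<eta>\<^sub>1 * \<kappa>mdc * amin * G\<^sup>2 / (psi \<beta> L (2 * \<mu>) / weight k) \<le> \<eta>\<^sub>1 * \<kappa>mdc * amin * G\<^sup>2 / P"
    using psi_hessian_le[of k] \<eta> \<kappa>mdc amin_facts P_pos psi_pos weight_pos[of k]
    by (intro divide_left_mono mult_nonneg_nonneg mult_pos_pos) (auto simp: P_def M_def)
  moreover have "\<eta>\<^sub>1 * \<kappa>mdc * amin * G\<^sup>2 / (psi \<beta> L (2 * \<mu>) / weight k)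
      = 2 * \<mu>c * (\<eta>\<^sub>1 * \<kappa>mdc * amin / psi \<beta> L (2 * \<mu>)) * weight k * gap k"
    unfolding G(2) by (simp only: times_divide_eq_left times_divide_eq_right divide_divide_eq_right mult_ac)
  ultimately show ?thesis using dec by linarith
qed

text \<open>
  Each success decreases \<open>ln (gap k)\<close> by at least a constant times its weight, since
  \<open>ln u \<le> u - 1\<close>; the decreases telescope.
\<close>
lemma sum_success_weights_le:
  "(\<Sum>k\<in>successes \<inter> {..<n}. weight k)
     \<le> psi \<beta> L (2 * \<mu>) / (\<eta>\<^sub>1 * \<kappa>mdc * amin) / (2 * \<mu>c) * ln (gap 0 / gap n)"
proof -
  define c where "c = 2 * \<mu>c * (\<eta>\<^sub>1 * \<kappa>mdc * amin / psi \<beta> L (2 * \<mu>))"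
  have c: "0 < c" using \<mu>c \<eta> \<kappa>mdc amin_facts psi_pos by (simp add: c_def)
  have "c * (\<Sum>k\<in>successes \<inter> {..<n}. weight k) \<le> ln (gap 0) - ln (gap n)"
  proof (induction n)
    case 0
    then show ?case by simp
  next
    case (Suc n)
    show ?case
    proof (cases "n \<in> successes")
      case True
      have "c * weight n \<le> 1 - gap (Suc n) / gap n"
        using success_decrease[OF True] gap_pos[of n] by (simp add: c_def field_simps)
      also have "\<dots> \<le> - ln (gap (Suc n) / gap n)"
        using ln_le_minus_one[of "gap (Suc n) / gap n"] gap_pos[of n] gap_pos[of "Suc n"] by simp
      also have "\<dots> = ln (gap n) - ln (gap (Suc n))"
        using gap_pos[of n] gap_pos[of "Suc n"] by (simp add: ln_divide_pos)
      finally have "c * weight n \<le> ln (gap n) - ln (gap (Suc n))" .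
      moreover have "successes \<inter> {..<Suc n} = insert n (successes \<inter> {..<n})" using True by auto
      ultimately show ?thesis using Suc by (simp add: distrib_left)
    next
      case False
      then have "successes \<inter> {..<Suc n} = successes \<inter> {..<n}" by (auto simp: less_Suc_eq)
      moreover have "gap (Suc n) = gap n" using False by (simp add: next_iterate)
      ultimately show ?thesis using Suc by simp
    qed
  qed
  then have "(\<Sum>k\<in>successes \<inter> {..<n}. weight k) \<le> ln (gap 0 / gap n) / c"
    using c gap_pos[of n] gap_pos[of 0] by (simp add: ln_divide_pos field_simps)
  also have "\<dots> = psi \<beta> L (2 * \<mu>) / (\<eta>\<^sub>1 * \<kappa>mdc * amin) / (2 * \<mu>c) * ln (gap 0 / gap n)"
    by (simp add: c_def mult_ac)
  finally show ?thesis .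
qed

text \<open>
  For \<open>\<alpha> < 1\<close>, \<open>\<epsilon>\<^sup>2 \<le> 2 * \<mu>c * \<epsilon>\<close> allows the tolerance itself to serve as a lower bound for the
  gradient norms.  For \<open>\<alpha> = 1\<close> the gradient norm has no influence on the radius bound, and both sides
  are \<open>1\<close>.
\<close>
lemma tolerance_powr_le:
  assumes "0 < \<epsilon>" "\<epsilon> < gap k" "\<alpha> = 1 \<or> \<epsilon> \<le> 2 * \<mu>c"
  shows "\<epsilon> powr (1 - \<alpha>) \<le> sqrt (2 * \<mu>c * gap k) powr (1 - \<alpha>)"
proof (cases "\<alpha> = 1")
  case True
  then show ?thesis using assms \<mu>c gap_pos[of k] by simp
next
  case False
  then have "\<epsilon> * \<epsilon> \<le> 2 * \<mu>c * gap k" using assms \<mu>c by (intro mult_mono) auto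
  then have "\<epsilon> \<le> sqrt (2 * \<mu>c * gap k)" by (intro real_le_rsqrt) (simp add: power2_eq_square)
  then show ?thesis using assms \<alpha> by (intro powr_mono2) auto
qed

text \<open>
  Few successes push the radius parameter down geometrically, while the lower bound keeps it above a
  multiple of the inverse of \<open>psi\<close>: the Hessian bound at \<open>k\<close> must be large, that is, the weight of \<open>k\<close>
  small.
\<close>
lemma weight_le_of_few_successes:
  assumes \<epsilon>: "0 < \<epsilon>" "\<epsilon> < gap k" "\<alpha> = 1 \<or> \<epsilon> \<le> 2 * \<mu>c"
    and a: "\<Delta>\<^sub>0 * \<gamma>\<^sub>2 ^ a \<le> amin * \<epsilon> powr (1 - \<alpha>)"
    and \<tau>: "0 < \<tau>" and few: "a + \<tau> * card (successes \<inter> {..<k}) \<le> k"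
  shows "weight k \<le> psi \<beta> L (2 * \<mu>) * (\<gamma>\<^sub>4 * \<gamma>\<^sub>2 ^ (\<tau> - 1)) powr (real (k - a) / real \<tau>)"
proof -
  let ?S = "card (successes \<inter> {..<k})" and ?E = "amin * \<epsilon> powr (1 - \<alpha>)"
    and ?q = "(\<gamma>\<^sub>4 * \<gamma>\<^sub>2 ^ (\<tau> - 1)) powr (real (k - a) / real \<tau>)"
  define M where "M = 2 * \<mu> / weight k"
  have M: "0 \<le> M" using \<mu> weight_pos[of k] by (simp add: M_def)
  have P: "0 < psi \<beta> L M" using psi_ge_one_plus[OF L M, of \<beta>] M by linarith
  have E: "0 < ?E" using amin_facts \<epsilon> by simp
  have "1 \<le> (1 + M) powr \<beta>" using M \<beta> by (intro ge_one_powr_ge_zero) auto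
  then have "?E * (1 / psi \<beta> L M)
      \<le> amin * sqrt (2 * \<mu>c * gap k) powr (1 - \<alpha>) * ((1 + M) powr \<beta> / psi \<beta> L M)"
    using amin_facts P tolerance_powr_le[OF \<epsilon>]
    by (intro mult_mono mult_left_mono divide_right_mono) auto
  also have "\<dots> \<le> \<Delta> k" unfolding M_def by (rule \<Delta>_ge)
  also have "\<dots> \<le> \<Delta>\<^sub>0 * \<gamma>\<^sub>4 ^ ?S * \<gamma>\<^sub>2 ^ (k - ?S)" by (rule \<Delta>_upper_bound)
  also have "k - ?S = a + (k - a - ?S)"
  proof -
    have "1 * ?S \<le> \<tau> * ?S" using \<tau> by (intro mult_le_mono1) simp
    then show ?thesis using few by linarith
  qed
  also have "\<Delta>\<^sub>0 * \<gamma>\<^sub>4 ^ ?S * \<gamma>\<^sub>2 ^ (a + (k - a - ?S))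
      = (\<Delta>\<^sub>0 * \<gamma>\<^sub>2 ^ a) * (\<gamma>\<^sub>4 ^ ?S * \<gamma>\<^sub>2 ^ (k - a - ?S))"
    by (simp add: power_add)
  also have "\<dots> \<le> ?E * ?q"
    using few \<gamma> \<tau> E by (intro mult_mono a geometric_product_le) auto
  finally have "?E * (1 / psi \<beta> L M) \<le> ?E * ?q" .
  then have "1 / psi \<beta> L M \<le> ?q" using E by (simp only: mult_le_cancel_left_pos)
  then have "psi \<beta> L (2 * \<mu>) * (1 / psi \<beta> L M) \<le> psi \<beta> L (2 * \<mu>) * ?q"
    using psi_pos by (intro mult_left_mono) auto
  moreover have "weight k \<le> psi \<beta> L (2 * \<mu>) * (1 / psi \<beta> L M)"
    using psi_hessian_le[of k] P weight_pos[of k] by (simp add: M_def field_simps)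
  ultimately show ?thesis by linarith
qed

text \<open>
  The indices in \<open>F\<close> are preceded by many successes and are charged to them; the remaining ones form
  part of a geometric series with sum \<open>\<xi>\<close>.
\<close>
lemma sum_weights_le:
  assumes \<epsilon>: "0 < \<epsilon>" "\<epsilon> < gap n" "\<alpha> = 1 \<or> \<epsilon> \<le> 2 * \<mu>c"
    and a: "\<Delta>\<^sub>0 * \<gamma>\<^sub>2 ^ a \<le> amin * \<epsilon> powr (1 - \<alpha>)"
    and \<tau>: "0 < \<tau>" and q: "\<gamma>\<^sub>4 * \<gamma>\<^sub>2 ^ (\<tau> - 1) < 1"
  shows "(\<Sum>k = a..<n. weight k)
    \<le> real \<tau> * (psi \<beta> L (2 * \<mu>) / (\<eta>\<^sub>1 * \<kappa>mdc * amin)) / (2 * \<mu>c) * ln (gap 0 / \<epsilon>)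
       + psi \<beta> L (2 * \<mu>) * (\<Sum>k. (\<gamma>\<^sub>4 * \<gamma>\<^sub>2 ^ (\<tau> - 1)) powr (real k / real \<tau>))"
proof -
  let ?q = "\<gamma>\<^sub>4 * \<gamma>\<^sub>2 ^ (\<tau> - 1)"
  let ?\<kappa> = "psi \<beta> L (2 * \<mu>) / (\<eta>\<^sub>1 * \<kappa>mdc * amin)"
  define F where "F = {k. a \<le> k \<and> k < a + \<tau> * card (successes \<inter> {..<k})}"
  have "{a..<n} \<inter> F = F \<inter> {..<n}" by (auto simp: F_def)
  then have split: "sum weight {a..<n} = sum weight (F \<inter> {..<n}) + sum weight ({a..<n} - F)"
    using sum.Int_Diff[of "{a..<n}" weight F] by simp
  have "sum weight (F \<inter> {..<n}) \<le> real \<tau> * sum weight (successes \<inter> {..<n})"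
    unfolding F_def
    using weight_antimono weight_pos by (intro sum_dominated_indices_le) (auto intro: less_imp_le)
  also have "\<dots> \<le> real \<tau> * (?\<kappa> / (2 * \<mu>c) * ln (gap 0 / \<epsilon>))"
  proof (intro mult_left_mono order_trans[OF sum_success_weights_le])
    have "gap 0 / gap n \<le> gap 0 / \<epsilon>"
      using \<epsilon> gap_pos[of 0] gap_pos[of n] by (intro divide_left_mono mult_pos_pos) auto
    then show "ln (gap 0 / gap n) \<le> ln (gap 0 / \<epsilon>)"
      using gap_pos[of 0] gap_pos[of n] by (intro ln_mono) auto
  qed (use psi_pos \<eta> \<kappa>mdc \<mu>c amin_facts in auto)
  finally have many: "sum weight (F \<inter> {..<n}) \<le> real \<tau> * ?\<kappa> / (2 * \<mu>c) * ln (gap 0 / \<epsilon>)"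
    by simp
  have q_pos: "0 < ?q" using \<gamma> by simp
  have "sum weight ({a..<n} - F)
      \<le> (\<Sum>k\<in>{a..<n} - F. psi \<beta> L (2 * \<mu>) * ?q powr (real (k - a) / real \<tau>))"
  proof (rule sum_mono)
    fix k assume k: "k \<in> {a..<n} - F"
    then have "\<epsilon> < gap k" using gap_antimono[of k n] \<epsilon> by auto
    then show "weight k \<le> psi \<beta> L (2 * \<mu>) * ?q powr (real (k - a) / real \<tau>)"
      using k \<epsilon> a \<tau> by (intro weight_le_of_few_successes) (auto simp: F_def)
  qed
  also have "\<dots> \<le> (\<Sum>k\<in>{a..<n}. psi \<beta> L (2 * \<mu>) * ?q powr (real (k - a) / real \<tau>))"
    using psi_pos by (intro sum_mono2) auto
  also have "\<dots> = psi \<beta> L (2 * \<mu>) * (\<Sum>k<n - a. ?q powr (real k / real \<tau>))"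
    unfolding sum_distrib_left
    by (rule sum.reindex_bij_witness[of _ "\<lambda>k. k + a" "\<lambda>k. k - a"]) auto
  also have "\<dots> \<le> psi \<beta> L (2 * \<mu>) * (\<Sum>k. ?q powr (real k / real \<tau>))"
    using psi_pos summable_powr_div[OF q_pos q \<tau>] by (intro mult_left_mono sum_le_suminf) auto
  finally show ?thesis using many split by linarith
qed

text \<open>
  The witness rounds up the real number \<open>e\<close> with \<open>\<Delta>\<^sub>0 * \<gamma>\<^sub>2 powr e = amin * \<epsilon> powr (1 - \<alpha>)\<close>; the
  rounding accounts for the summand \<open>1\<close>.  The definition of \<open>amin\<close> makes \<open>e\<close> positive, so \<open>a \<ge> 1\<close>,
  which keeps the range of summation away from the singularity of \<open>u powr (- p)\<close> at \<open>0\<close>.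
\<close>
lemma obtain_offset:
  assumes \<epsilon>: "0 < \<epsilon>" "\<epsilon> < gap 0" "\<alpha> = 1 \<or> \<epsilon> \<le> 2 * \<mu>c"
  obtains a :: nat where "1 \<le> a" "real a \<le> (1 - \<alpha>) * log \<gamma>\<^sub>2 \<epsilon> + (log \<gamma>\<^sub>2 (amin / \<Delta>\<^sub>0) + 1)"
    "\<Delta>\<^sub>0 * \<gamma>\<^sub>2 ^ a \<le> amin * \<epsilon> powr (1 - \<alpha>)"
proof
  define z where "z = \<epsilon> powr (1 - \<alpha>) * (amin / \<Delta>\<^sub>0)"
  define e where "e = log \<gamma>\<^sub>2 z"
  have \<gamma>2: "0 < \<gamma>\<^sub>2" "\<gamma>\<^sub>2 < 1" using \<gamma> by auto
  have z: "0 < z" using \<epsilon> amin_facts \<Delta>\<^sub>0 by (simp add: z_def)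
  have "\<epsilon> powr (1 - \<alpha>) \<le> norm (g x\<^sub>0) powr (1 - \<alpha>)"
  proof (rule order_trans[OF tolerance_powr_le[OF \<epsilon>] powr_mono2])
    show "sqrt (2 * \<mu>c * gap 0) \<le> norm (g x\<^sub>0)" using gradient_ge[of 0 0] by (simp add: start)
    show "0 \<le> sqrt (2 * \<mu>c * gap 0)" using \<mu>c gap_pos[of 0] by simp
  qed (use \<alpha> in simp)
  then have "amin * \<epsilon> powr (1 - \<alpha>) \<le> amin * norm (g x\<^sub>0) powr (1 - \<alpha>)"
    using amin_facts by (intro mult_left_mono) auto
  then have "amin * \<epsilon> powr (1 - \<alpha>) < \<Delta>\<^sub>0" using amin_facts(3) by linarith
  then have "z < 1" using \<Delta>\<^sub>0 by (simp add: z_def field_simps)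
  then have e_pos: "0 < e" using z \<gamma>2 by (simp add: e_def log_def divide_neg_neg)
  have e_eq: "e = (1 - \<alpha>) * log \<gamma>\<^sub>2 \<epsilon> + log \<gamma>\<^sub>2 (amin / \<Delta>\<^sub>0)"
    using \<epsilon> amin_facts \<Delta>\<^sub>0 \<gamma>2 unfolding e_def z_def by (subst log_mult) (auto simp: log_powr)
  show "1 \<le> nat \<lceil>e\<rceil>" using e_pos by linarith
  show "real (nat \<lceil>e\<rceil>) \<le> (1 - \<alpha>) * log \<gamma>\<^sub>2 \<epsilon> + (log \<gamma>\<^sub>2 (amin / \<Delta>\<^sub>0) + 1)"
    using e_pos e_eq by linarith
  have "\<gamma>\<^sub>2 ^ nat \<lceil>e\<rceil> = \<gamma>\<^sub>2 powr real (nat \<lceil>e\<rceil>)" using \<gamma>2 by (simp add: powr_realpow)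
  also have "\<dots> \<le> \<gamma>\<^sub>2 powr e" using \<gamma>2 by (intro powr_mono') (auto intro: real_nat_ceiling_ge)
  also have "\<dots> = z" using \<gamma>2 z by (simp add: e_def)
  finally show "\<Delta>\<^sub>0 * \<gamma>\<^sub>2 ^ nat \<lceil>e\<rceil> \<le> amin * \<epsilon> powr (1 - \<alpha>)"
    using \<Delta>\<^sub>0 by (simp add: z_def field_simps)
qed

end

section \<open>The iteration bounds\<close>
lemma strongly_convex_imp_gradient_dominated:
  fixes f :: "'a::real_inner \<Rightarrow> real"
  assumes c: "0 < c" and convex: "\<And>y z. f z \<ge> f y + g y \<bullet> (z - y) + c / 2 * (norm (z - y))\<^sup>2"
    and m: "m \<in> range f"
  shows "2 * c * (f y - m) \<le> (norm (g y))\<^sup>2"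
proof -
  obtain z where z: "m = f z" using m by blast
  have square: "(norm (u + c *\<^sub>R d))\<^sup>2 = (norm u)\<^sup>2 + 2 * c * (u \<bullet> d) + c\<^sup>2 * (norm d)\<^sup>2" for u d :: 'a
    unfolding power2_norm_eq_inner
    by (simp add: inner_add_left inner_add_right inner_commute power2_eq_square[of c] algebra_simps)
  \<comment> \<open>Completing the square: the quadratic lower model in \<open>z\<close> has minimum value
    \<open>f y - (norm (g y))\<^sup>2 / (2 * c)\<close>.\<close>
  have "0 \<le> (norm (g y + c *\<^sub>R (z - y)))\<^sup>2" by simp
  also have "\<dots> = (norm (g y))\<^sup>2 + 2 * c * (g y \<bullet> (z - y) + c / 2 * (norm (z - y))\<^sup>2)"
    unfolding square by (simp add: distrib_left power2_eq_square[of c])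
  also have "\<dots> \<le> (norm (g y))\<^sup>2 + 2 * c * (m - f y)"
    using convex[of y z] c unfolding z by (intro add_left_mono mult_left_mono) auto
  finally show ?thesis by (simp add: algebra_simps)
qed

theorem theorem12:
  fixes f :: "real^'n \<Rightarrow> real" and g :: "real^'n \<Rightarrow> real^'n"
    and x\<^sub>0 :: "real^'n" and x s :: "nat \<Rightarrow> real^'n" and B :: "nat \<Rightarrow> real^'n^'n"
    and t \<Delta> \<delta> :: "nat \<Rightarrow> real"
    and \<eta>\<^sub>1 \<eta>\<^sub>2 \<gamma>\<^sub>1 \<gamma>\<^sub>2 \<gamma>\<^sub>3 \<gamma>\<^sub>4 \<kappa>mdc \<alpha> \<beta> \<Delta>\<^sub>0 :: real
    and flow \<mu>c L \<mu> p amin \<xi> \<kappa>\<^sub>0 \<kappa>\<^sub>3 \<kappa>\<^sub>4 :: real and \<tau> :: nat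
  assumes "0 < \<eta>\<^sub>1" "\<eta>\<^sub>1 \<le> \<eta>\<^sub>2" "\<eta>\<^sub>2 < 1"
    and "0 < \<gamma>\<^sub>1" "\<gamma>\<^sub>1 \<le> \<gamma>\<^sub>2" "\<gamma>\<^sub>2 < 1" "1 \<le> \<gamma>\<^sub>3" "\<gamma>\<^sub>3 \<le> \<gamma>\<^sub>4"
    and "0 < \<kappa>mdc" "\<kappa>mdc \<le> 1/2"
    and "-1 \<le> \<alpha>" "\<alpha> \<le> 1" "0 \<le> \<beta>" "\<beta> \<le> 1" "0 < \<Delta>\<^sub>0"
    and gradient: "\<And>y. GDERIV f y :> g y" and "continuous_on UNIV g"
    and minimum: "flow \<in> range f" "\<And>y. flow \<le> f y"
    and "0 < \<mu>c"
    and strongly_convex: "\<And>y z. f z \<ge> f y + g y \<bullet> (z - y) + \<mu>c / 2 * (norm (z - y))\<^sup>2"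
    and run: "trust_region_run \<eta>\<^sub>1 \<eta>\<^sub>2 \<gamma>\<^sub>1 \<gamma>\<^sub>2 \<gamma>\<^sub>3 \<gamma>\<^sub>4 \<kappa>mdc \<alpha> \<beta> f g x\<^sub>0 \<Delta>\<^sub>0 x B t s \<Delta>"
    and "1 \<le> L"
    and model_error: "\<And>k. \<bar>f (x k + s k) - tr_model f g (x k) (B k) (s k)\<bar>
                            \<le> 1/2 * (L + opnorm (B k)) * (norm (s k))\<^sup>2"
    and "0 < \<mu>" "0 < p" "p \<le> 1"
    and hessian_growth: "\<And>k. Max ((\<lambda>j. opnorm (B j)) ` {0..k}) \<le> \<mu> * (1 + real k powr p)"
    and "infinite {k. tr_ratio f g (x k) (B k) (s k) \<ge> \<eta>\<^sub>1}"
    and "0 < \<tau>" "\<gamma>\<^sub>4 * \<gamma>\<^sub>2 ^ (\<tau> - 1) < 1"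
    and "\<xi> = (\<Sum>k. (\<gamma>\<^sub>4 * \<gamma>\<^sub>2 ^ (\<tau> - 1)) powr (real k / real \<tau>))"
    and "amin = 2 * \<gamma>\<^sub>1 * \<kappa>mdc * (1 - \<eta>\<^sub>2) * min 1 (\<Delta>\<^sub>0 / rpow (norm (g x\<^sub>0)) (1 - \<alpha>))"
    and "\<kappa>\<^sub>0 = psi \<beta> L (2 * \<mu>) / (\<eta>\<^sub>1 * \<kappa>mdc * amin)"
    and "\<kappa>\<^sub>3 = psi \<beta> L (2 * \<mu>) * \<xi>"
    and "\<kappa>\<^sub>4 = log \<gamma>\<^sub>2 (amin / \<Delta>\<^sub>0) + 1"
    and "\<And>k. \<delta> k = f (x k) - flow"
  shows
    "(p < 1 \<longrightarrow>
       (\<forall>\<epsilon>>0. \<forall>khat. first_crossing \<delta> \<epsilon> khat \<and> (\<alpha> = 1 \<or> \<epsilon> \<le> 2 * \<mu>c) \<longrightarrow>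
          real khat \<le>
            ((1 - p) * (real \<tau> * \<kappa>\<^sub>0 / (2 * \<mu>c) * ln (\<delta> 0 / \<epsilon>) + \<kappa>\<^sub>3)
              + ((1 - \<alpha>) * log \<gamma>\<^sub>2 \<epsilon> + \<kappa>\<^sub>4) powr (1 - p)) powr (1 / (1 - p))) \<and>
       (\<lambda>\<epsilon>. ((1 - p) * (real \<tau> * \<kappa>\<^sub>0 / (2 * \<mu>c) * ln (\<delta> 0 / \<epsilon>) + \<kappa>\<^sub>3)
              + ((1 - \<alpha>) * log \<gamma>\<^sub>2 \<epsilon> + \<kappa>\<^sub>4) powr (1 - p)) powr (1 / (1 - p)))
         \<in> O[at_right 0](\<lambda>\<epsilon>. ((1 - p) * ln (inverse \<epsilon>)) powr (1 / (1 - p)))) \<and>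
     (p = 1 \<longrightarrow>
       (\<forall>\<epsilon>>0. \<forall>khat. first_crossing \<delta> \<epsilon> khat \<and> (\<alpha> = 1 \<or> \<epsilon> \<le> 2 * \<mu>c) \<longrightarrow>
          real khat \<le>
            ((1 - \<alpha>) * log \<gamma>\<^sub>2 \<epsilon> + \<kappa>\<^sub>4)
              * exp (real \<tau> * \<kappa>\<^sub>0 / (2 * \<mu>c) * ln (\<delta> 0 / \<epsilon>) + \<kappa>\<^sub>3)) \<and>
       (\<lambda>\<epsilon>. ((1 - \<alpha>) * log \<gamma>\<^sub>2 \<epsilon> + \<kappa>\<^sub>4)
              * exp (real \<tau> * \<kappa>\<^sub>0 / (2 * \<mu>c) * ln (\<delta> 0 / \<epsilon>) + \<kappa>\<^sub>3))
         \<in> O[at_right 0](\<lambda>\<epsilon>. ((1 - \<alpha>) * log \<gamma>\<^sub>2 \<epsilon> + \<kappa>\<^sub>4)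
              * \<epsilon> powr (- (real \<tau> * \<kappa>\<^sub>0 / (2 * \<mu>c)))))"
proof -
  have opnorm_le: "opnorm (B j) \<le> \<mu> * (1 + real k powr p)" if "j \<le> k" for j k
  proof -
    have "opnorm (B j) \<le> Max ((\<lambda>j. opnorm (B j)) ` {0..k})" using that by (intro Max_ge) auto
    then show ?thesis using hessian_growth[of k] by linarith
  qed
  interpret gradient_dominated_trust_region f g x\<^sub>0 x s B t \<Delta> \<eta>\<^sub>1 \<eta>\<^sub>2 \<gamma>\<^sub>1 \<gamma>\<^sub>2 \<gamma>\<^sub>3 \<gamma>\<^sub>4 \<kappa>mdc \<alpha> \<beta> \<Delta>\<^sub>0 L amin
    flow \<mu>c \<mu> p
  proof unfold_locales
    show "2 * \<mu>c * (f y - flow) \<le> (norm (g y))\<^sup>2" for y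
      using strongly_convex_imp_gradient_dominated[OF \<open>0 < \<mu>c\<close> strongly_convex] minimum(1) by blast
  qed (fact assms | fact opnorm_le)+
  have \<delta>: "\<delta> k = gap k" for k using assms by simp
  define c where "c = real \<tau> * \<kappa>\<^sub>0 / (2 * \<mu>c)"
  have \<kappa>0: "0 \<le> \<kappa>\<^sub>0" using psi_pos amin_facts \<eta> \<kappa>mdc \<open>\<kappa>\<^sub>0 = _\<close> by simp
  then have c: "0 \<le> c" using \<mu>c by (simp add: c_def)
  have q: "0 < \<gamma>\<^sub>4 * \<gamma>\<^sub>2 ^ (\<tau> - 1)" using \<gamma> by simp
  have "0 \<le> \<xi>"
    unfolding \<open>\<xi> = _\<close> using summable_powr_div[OF q] assms by (intro suminf_nonneg) auto
  then have \<kappa>3: "0 \<le> \<kappa>\<^sub>3" using psi_pos \<open>\<kappa>\<^sub>3 = _\<close> by simp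
  have \<kappa>4: "0 \<le> \<kappa>\<^sub>4" if "\<alpha> = 1"
  proof -
    have "amin < \<Delta>\<^sub>0" using amin_facts(3) gradient_start_nonzero that by simp
    then have "0 < log \<gamma>\<^sub>2 (amin / \<Delta>\<^sub>0)"
      using \<gamma> \<Delta>\<^sub>0 amin_facts by (simp add: log_def divide_neg_neg)
    then show ?thesis using \<open>\<kappa>\<^sub>4 = _\<close> by simp
  qed
  \<comment> \<open>A common form of both cases: the offset \<open>a\<close> and the weighted count of iterations.\<close>
  have key: "\<exists>a. 1 \<le> a \<and> real a \<le> (1 - \<alpha>) * log \<gamma>\<^sub>2 \<epsilon> + \<kappa>\<^sub>4
      \<and> (\<Sum>k = a..<khat. weight k) \<le> c * ln (\<delta> 0 / \<epsilon>) + \<kappa>\<^sub>3 \<and> 0 \<le> c * ln (\<delta> 0 / \<epsilon>) + \<kappa>\<^sub>3"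
    if \<epsilon>: "0 < \<epsilon>" and crossing: "first_crossing \<delta> \<epsilon> khat \<and> (\<alpha> = 1 \<or> \<epsilon> \<le> 2 * \<mu>c)" for \<epsilon> khat
  proof -
    have gap: "\<epsilon> < gap khat" "\<epsilon> < gap 0" and cond: "\<alpha> = 1 \<or> \<epsilon> \<le> 2 * \<mu>c"
      using crossing gap_antimono[of 0 khat] by (auto simp: first_crossing_def \<delta>)
    obtain a where a: "1 \<le> a"
      "real a \<le> (1 - \<alpha>) * log \<gamma>\<^sub>2 \<epsilon> + (log \<gamma>\<^sub>2 (amin / \<Delta>\<^sub>0) + 1)"
      "\<Delta>\<^sub>0 * \<gamma>\<^sub>2 ^ a \<le> amin * \<epsilon> powr (1 - \<alpha>)"
      using obtain_offset[OF \<epsilon> gap(2) cond] .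
    have "(\<Sum>k = a..<khat. weight k) \<le> c * ln (\<delta> 0 / \<epsilon>) + \<kappa>\<^sub>3"
      using sum_weights_le[OF \<epsilon> gap(1) cond a(3) \<open>0 < \<tau>\<close> \<open>\<gamma>\<^sub>4 * \<gamma>\<^sub>2 ^ (\<tau> - 1) < 1\<close>]
      unfolding c_def \<delta> \<open>\<kappa>\<^sub>0 = _\<close> \<open>\<kappa>\<^sub>3 = _\<close> \<open>\<xi> = _\<close> .
    moreover have "0 \<le> ln (\<delta> 0 / \<epsilon>)" using gap(2) \<epsilon> by (simp add: \<delta>)
    ultimately show ?thesis using a c \<kappa>3 \<open>\<kappa>\<^sub>4 = _\<close> by (intro exI[of _ a]) auto
  qed
  have weight_eq: "(\<Sum>k = a..<n. weight k) = (\<Sum>k = a..<n. real k powr (- p))" if "1 \<le> a" for a n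
    using that by (intro sum.cong) (auto simp: weight_def max_def)
  show ?thesis
  proof (intro conjI impI allI)
    fix \<epsilon> :: real and khat
    assume p1: "p < 1" and \<epsilon>: "0 < \<epsilon>"
      and crossing: "first_crossing \<delta> \<epsilon> khat \<and> (\<alpha> = 1 \<or> \<epsilon> \<le> 2 * \<mu>c)"
    let ?K = "(1 - \<alpha>) * log \<gamma>\<^sub>2 \<epsilon> + \<kappa>\<^sub>4" and ?R = "c * ln (\<delta> 0 / \<epsilon>) + \<kappa>\<^sub>3"
    obtain a where a: "1 \<le> a" "real a \<le> ?K" "(\<Sum>k = a..<khat. weight k) \<le> ?R" and R: "0 \<le> ?R"
      using key[OF \<epsilon> crossing] by blast
    have mono: "real a powr (1 - p) \<le> ?K powr (1 - p)" using a p1 by (intro powr_mono2) auto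
    have bound: "real khat powr (1 - p) \<le> (1 - p) * ?R + ?K powr (1 - p)"
    proof (cases "a \<le> khat")
      case True
      have "real khat powr (1 - p) - real a powr (1 - p) \<le> (1 - p) * (\<Sum>k = a..<khat. weight k)"
        using integral_le_sum_powr[of p a khat] p p1 a(1) True by (simp add: weight_eq)
      also have "\<dots> \<le> (1 - p) * ?R" using a p1 by (intro mult_left_mono) auto
      finally show ?thesis using mono by linarith
    next
      case False
      then have "real khat powr (1 - p) \<le> real a powr (1 - p)" using p1 by (intro powr_mono2) auto
      moreover have "0 \<le> (1 - p) * ?R" using R p1 by (intro mult_nonneg_nonneg) auto
      ultimately show ?thesis using mono by linarith
    qed
    have "real khat = (real khat powr (1 - p)) powr (1 / (1 - p))" using p1 by (simp add: powr_powr)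
    also have "\<dots> \<le> ((1 - p) * ?R + ?K powr (1 - p)) powr (1 / (1 - p))"
      using bound p1 by (intro powr_mono2) auto
    finally show "real khat \<le> ((1 - p) * (real \<tau> * \<kappa>\<^sub>0 / (2 * \<mu>c) * ln (\<delta> 0 / \<epsilon>) + \<kappa>\<^sub>3)
        + ((1 - \<alpha>) * log \<gamma>\<^sub>2 \<epsilon> + \<kappa>\<^sub>4) powr (1 - p)) powr (1 / (1 - p))"
      unfolding c_def .
  next
    assume "p < 1"
    then show "(\<lambda>\<epsilon>. ((1 - p) * (real \<tau> * \<kappa>\<^sub>0 / (2 * \<mu>c) * ln (\<delta> 0 / \<epsilon>) + \<kappa>\<^sub>3)
        + ((1 - \<alpha>) * log \<gamma>\<^sub>2 \<epsilon> + \<kappa>\<^sub>4) powr (1 - p)) powr (1 / (1 - p)))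
      \<in> O[at_right 0](\<lambda>\<epsilon>. ((1 - p) * ln (inverse \<epsilon>)) powr (1 / (1 - p)))"
      using c \<kappa>3 \<kappa>4 \<gamma> \<alpha> p gap_pos[of 0] unfolding c_def
      by (intro rate_bound_bigo) (auto simp: \<delta>)
  next
    fix \<epsilon> :: real and khat
    assume p1: "p = 1" and \<epsilon>: "0 < \<epsilon>"
      and crossing: "first_crossing \<delta> \<epsilon> khat \<and> (\<alpha> = 1 \<or> \<epsilon> \<le> 2 * \<mu>c)"
    let ?K = "(1 - \<alpha>) * log \<gamma>\<^sub>2 \<epsilon> + \<kappa>\<^sub>4" and ?R = "c * ln (\<delta> 0 / \<epsilon>) + \<kappa>\<^sub>3"
    obtain a where a: "1 \<le> a" "real a \<le> ?K" "(\<Sum>k = a..<khat. weight k) \<le> ?R" and R: "0 \<le> ?R"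
      using key[OF \<epsilon> crossing] by blast
    have "real khat \<le> real a * exp ?R"
    proof (cases "a \<le> khat")
      case True
      have "ln (real khat) - ln (real a) \<le> ?R"
        using ln_le_sum_inverse[OF a(1) True] weight_eq[OF a(1), of khat] a(3)
        unfolding p1 by linarith
      then have "ln (real khat) \<le> ln (real a * exp ?R)"
        using a(1) by (simp add: ln_mult_pos)
      then show ?thesis using a(1) True by (subst (asm) ln_le_cancel_iff) auto
    next
      case False
      have "real a * 1 \<le> real a * exp ?R" using R by (intro mult_left_mono) auto
      then show ?thesis using False by linarith
    qed
    also have "\<dots> \<le> ?K * exp ?R" using a by (intro mult_right_mono) auto
    finally show "real khat \<le> ((1 - \<alpha>) * log \<gamma>\<^sub>2 \<epsilon> + \<kappa>\<^sub>4)
        * exp (real \<tau> * \<kappa>\<^sub>0 / (2 * \<mu>c) * ln (\<delta> 0 / \<epsilon>) + \<kappa>\<^sub>3)"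
      unfolding c_def .
  next
    show "(\<lambda>\<epsilon>. ((1 - \<alpha>) * log \<gamma>\<^sub>2 \<epsilon> + \<kappa>\<^sub>4)
        * exp (real \<tau> * \<kappa>\<^sub>0 / (2 * \<mu>c) * ln (\<delta> 0 / \<epsilon>) + \<kappa>\<^sub>3))
      \<in> O[at_right 0](\<lambda>\<epsilon>. ((1 - \<alpha>) * log \<gamma>\<^sub>2 \<epsilon> + \<kappa>\<^sub>4) * \<epsilon> powr (- (real \<tau> * \<kappa>\<^sub>0 / (2 * \<mu>c))))"
      using gap_pos[of 0] by (intro exp_ln_bound_bigo) (simp add: \<delta>)
  qed
qed

end
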